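(* Let $I$ be a homogeneous complete intersection of $R=k[x_0,\ldots,x_n]$ of type $(d_1,\ldots,d_r)$, and let $s$ be any positive integer. Then the Herzog-Huneke-Srinivasan conjecture is true for $R/I^s$: writing the graded minimal free resolution of $R/I^s$ as \[ 0 \longrightarrow \bigoplus_{j=1}^{b_r} R(-d_{rj}) \longrightarrow \cdots \longrightarrow \bigoplus_{j=1}^{b_1} R(-d_{1j}) \longrightarrow R \longrightarrow R/I^s \longrightarrow 0, \] and setting $m_i=\min\{d_{ij}\mid j=1,\ldots,b_i\}$ and $M_i=\max\{d_{ij}\mid j=1,\ldots,b_i\}$ for $i=1,\ldots,r$, one has \[ \frac{\prod_{i=1}^r m_i}{r!} \leq e(R/I^s) \leq \frac{\prod_{i=1}^r M_i}{r!}. \]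
   Context: $k$ is an infinite field of characteristic $0$ and $R=k[x_0,\ldots,x_n]$ has the standard grading; $R(-d)$ is the graded free module of rank one with generator in degree $d$. A homogeneous ideal $I=(F_1,\ldots,F_r)\subseteq R$ is a complete intersection of type $(d_1,\ldots,d_r)$ if $F_1,\ldots,F_r$ is a regular sequence on $R$ of homogeneous forms with $\deg F_i=d_i$. $e(R/J)$ denotes the multiplicity of $R/J$. The ring $R/I^s$ is Cohen-Macaulay and its graded minimal free resolution has length $r$. *)

theory Defs
  imports
    Complex_Main
    "HOL-Library.Poly_Mapping"
    "HOL-Computational_Algebra.Polynomial"
    "Jordan_Normal_Form.Matrix_Kernel"
begin

text \<open>
  The polynomial ring \<open>k[x\<^sub>0, \<dots>, x\<^sub>n]\<close>: the variables are indexed by a finite type \<open>'x\<close>, so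
  \<open>CARD('x) = n + 1\<close>. Finitely supported exponent functions are the monomials, and the product
  of \<open>HOL-Library.Poly_Mapping\<close> is the convolution product.
\<close>

type_synonym ('x, 'k) mpoly = "('x \<Rightarrow>\<^sub>0 nat) \<Rightarrow>\<^sub>0 'k"

definition Var :: "'x \<Rightarrow> ('x, 'k::comm_ring_1) mpoly"
  where "Var x = Poly_Mapping.single (Poly_Mapping.single x 1) 1"

definition mpoly_scale :: "'k::comm_ring_1 \<Rightarrow> ('x, 'k) mpoly \<Rightarrow> ('x, 'k) mpoly"
  where "mpoly_scale c p = Poly_Mapping.single 0 c * p"

definition mdeg :: "('x::finite \<Rightarrow>\<^sub>0 nat) \<Rightarrow> nat"
  where "mdeg m = (\<Sum>x\<in>UNIV. Poly_Mapping.lookup m x)"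

text \<open>
  The graded component \<open>R\<^sub>d\<close>, for integer \<open>d\<close>; it is \<open>{0}\<close> when \<open>d < 0\<close>, and it always contains \<open>0\<close>.
\<close>

definition graded_part :: "int \<Rightarrow> ('x::finite, 'k::comm_ring_1) mpoly set"
  where "graded_part d = {p. \<forall>m\<in>Poly_Mapping.keys p. int (mdeg m) = d}"


abbreviation ideal_gen :: "'a::comm_ring_1 set \<Rightarrow> 'a set"
  where "ideal_gen \<equiv> Modules.module.span (*)"

definition ideal_power :: "'a::comm_ring_1 set \<Rightarrow> nat \<Rightarrow> 'a set"
  where "ideal_power I s = ideal_gen {\<Prod>i<s. f i | f. \<forall>i<s. f i \<in> I}"

definition irrelevant_ideal :: "('x, 'k::comm_ring_1) mpoly set"
  where "irrelevant_ideal = ideal_gen (range Var)"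

definition regular_sequence :: "'a::comm_ring_1 list \<Rightarrow> bool"
  where "regular_sequence Fs \<longleftrightarrow>
    (\<forall>i<length Fs. \<forall>g. Fs ! i * g \<in> ideal_gen (set (take i Fs)) \<longrightarrow> g \<in> ideal_gen (set (take i Fs))) \<and>
    ideal_gen (set Fs) \<noteq> UNIV"

text \<open>
  Regularity forces the forms to be nonzero and nonconstant, so membership of \<open>F\<^sub>i\<close> in
  \<open>R\<^bsub>d\<^sub>i\<^esub>\<close> says that \<open>F\<^sub>i\<close> has degree \<open>d\<^sub>i\<close>, and that \<open>d\<^sub>i \<ge> 1\<close>.
\<close>

definition complete_intersection :: "('x::finite, 'k::comm_ring_1) mpoly set \<Rightarrow> nat list \<Rightarrow> bool"
  where "complete_intersection I ds \<longleftrightarrow>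
    (\<exists>Fs. length Fs = length ds \<and> (\<forall>i<length ds. Fs ! i \<in> graded_part (int (ds ! i))) \<and>
      regular_sequence Fs \<and> I = ideal_gen (set Fs))"


text \<open>
  \<open>dim\<^sub>k (R/J)\<^sub>d\<close> for a homogeneous ideal \<open>J\<close>, using \<open>(R/J)\<^sub>d = R\<^sub>d / (J \<inter> R\<^sub>d)\<close>. As \<open>R\<^sub>d\<close> is
  finite-dimensional, the subtraction of natural numbers does not truncate.
\<close>

definition hilbert_function :: "('x::finite, 'k::field) mpoly set \<Rightarrow> nat \<Rightarrow> nat"
  where "hilbert_function J d =
    Vector_Spaces.vector_space.dim mpoly_scale (graded_part (int d) :: ('x, 'k) mpoly set) -
    Vector_Spaces.vector_space.dim mpoly_scale (J \<inter> graded_part (int d))"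

definition hilbert_polynomial :: "('x::finite, 'k::field) mpoly set \<Rightarrow> real poly"
  where "hilbert_polynomial J =
    (THE P. \<forall>\<^sub>F d in sequentially. real (hilbert_function J d) = poly P (real d))"

text \<open>
  The multiplicity \<open>e(R/J)\<close>: if \<open>R/J\<close> has dimension \<open>\<delta> > 0\<close>, the Hilbert polynomial has degree
  \<open>\<delta> - 1\<close>, and the multiplicity is \<open>(\<delta> - 1)!\<close> times its leading coefficient; if \<open>R/J\<close> has finite
  length, i.e. the Hilbert polynomial vanishes, the multiplicity is that length.
\<close>

definition quotient_multiplicity :: "('x::finite, 'k::field) mpoly set \<Rightarrow> real"
  where "quotient_multiplicity J =
    (let P = hilbert_polynomial J in
     if P = 0 then (\<Sum>d | hilbert_function J d \<noteq> 0. real (hilbert_function J d))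
     else fact (degree P) * lead_coeff P)"


text \<open>
  A graded free resolution
  \<open>0 \<rightarrow> F\<^sub>r \<rightarrow> \<dots> \<rightarrow> F\<^sub>1 \<rightarrow> F\<^sub>0 = R \<rightarrow> R/J \<rightarrow> 0\<close> with \<open>F\<^sub>i = \<Oplus>\<^sub>j R(-d\<^sub>i\<^sub>j)\<close>. The list \<open>D i\<close> consists of
  the shifts \<open>d\<^sub>i\<^sub>j\<close>, and \<open>\<phi> i\<close> is the matrix of \<open>F\<^sub>i \<rightarrow> F\<^bsub>i-1\<^esub>\<close> for the standard bases, acting on
  column vectors. The map has degree \<open>0\<close> iff entry \<open>(j, l)\<close> is homogeneous of degree
  \<open>d\<^sub>i\<^sub>l - d\<^bsub>i-1,j\<^esub>\<close>. With \<open>F\<^bsub>r+1\<^esub> = 0\<close>, exactness at \<open>F\<^sub>r\<close> is the injectivity of \<open>\<phi> r\<close>.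
\<close>

definition graded_free_resolution ::
  "('x::finite, 'k::comm_ring_1) mpoly set \<Rightarrow> nat \<Rightarrow> (nat \<Rightarrow> int list) \<Rightarrow>
    (nat \<Rightarrow> ('x, 'k) mpoly mat) \<Rightarrow> bool"
  where "graded_free_resolution J r D \<phi> \<longleftrightarrow>
    D 0 = [0] \<and> D (Suc r) = [] \<and>
    (\<forall>i\<in>{1..Suc r}. \<phi> i \<in> carrier_mat (length (D (i - 1))) (length (D i)) \<and>
      (\<forall>j<length (D (i - 1)). \<forall>l<length (D i).
        \<phi> i $$ (j, l) \<in> graded_part (D i ! l - D (i - 1) ! j))) \<and>
    (\<lambda>v. (\<phi> 1 *\<^sub>v v) $ 0) ` carrier_vec (length (D 1)) = J \<and>
    (\<forall>i\<in>{1..r}. mat_kernel (\<phi> i) = (\<lambda>v. \<phi> (Suc i) *\<^sub>v v) ` carrier_vec (length (D (Suc i))))"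

text \<open>
  Minimality is \<open>\<phi> i (F\<^sub>i) \<subseteq> \<mm> F\<^bsub>i-1\<^esub>\<close> for all \<open>i\<close>, where \<open>\<mm>\<close> is the irrelevant maximal ideal.
\<close>

definition minimal_graded_free_resolution ::
  "('x::finite, 'k::comm_ring_1) mpoly set \<Rightarrow> nat \<Rightarrow> (nat \<Rightarrow> int list) \<Rightarrow>
    (nat \<Rightarrow> ('x, 'k) mpoly mat) \<Rightarrow> bool"
  where "minimal_graded_free_resolution J r D \<phi> \<longleftrightarrow>
    graded_free_resolution J r D \<phi> \<and>
    (\<forall>i\<in>{1..r}. \<forall>j<length (D (i - 1)). \<forall>l<length (D i). \<phi> i $$ (j, l) \<in> irrelevant_ideal)"


text \<open>The library notions used above are meaningful: the underlying locales are inhabited.\<close>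

lemma module_times: "Modules.module ((*) :: 'a::comm_ring_1 \<Rightarrow> 'a \<Rightarrow> 'a)"
  by unfold_locales (simp_all add: algebra_simps)

lemma vector_space_mpoly_scale:
  "Vector_Spaces.vector_space (mpoly_scale :: 'k::field \<Rightarrow> ('x, 'k) mpoly \<Rightarrow> ('x, 'k) mpoly)"
  by unfold_locales
    (simp_all add: mpoly_scale_def single_add mult_single distrib_left distrib_right
      mult.assoc[symmetric])

end

theory Submission
  imports Defs "HOL-Library.Cardinality"
begin

text \<open>
  Let \<open>I = (F\<^sub>1, \<dots>, F\<^sub>r)\<close>. A homogeneous regular sequence may be permuted, and this gives
  \<open>((A + T\<^sup>s) : t) = A + T\<^bsup>s-1\<^esup>\<close> for \<open>t \<in> T\<close> whenever \<open>A\<close> and \<open>T\<close> are generated by disjoint parts of the sequence.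
  Additivity of Hilbert functions along multiplication by \<open>t\<close> then turns Pascal's rule into
  \<open>e(R/I\<^sup>s) = binom(s + r - 1, r) d\<^sub>1 \<cdots> d\<^sub>r\<close>.

  The whole Betti table is not needed: it suffices that, for every ordering of the forms, the shift
  \<open>s d\<^sub>1 + d\<^sub>2 + \<cdots> + d\<^sub>i\<close> occurs in homological degree \<open>i\<close>. Multiplication by \<open>F\<^sub>1\<^bsup>s-1\<^esup>\<close> lifts to a chain
  map from the Koszul complex on \<open>F\<^sub>1, \<dots>, F\<^sub>r\<close> to the given resolution, and \<open>R/I\<^sup>s \<rightarrow> R/(F\<^sub>1\<^sup>s, F\<^sub>2, \<dots>, F\<^sub>r)\<close>
  lifts to a chain map from the resolution to the Koszul complex on \<open>F\<^sub>1\<^sup>s, F\<^sub>2, \<dots>, F\<^sub>r\<close>. The composite is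
  known explicitly up to homotopy and does not vanish modulo the irrelevant ideal.

  Ordering the \<open>d\<^sub>i\<close> increasingly gives \<open>m\<^sub>i \<le> s d\<^sub>1 + \<cdots> + d\<^sub>i \<le> (s + i - 1) d\<^sub>i\<close>, ordering them
  decreasingly gives the opposite inequalities for \<open>M\<^sub>i\<close>, and multiplying over \<open>i\<close> yields both bounds.
\<close>

section \<open>Non-zero-divisors modulo ideals and regular sequences\<close>

text \<open>Both bounds meet at one number. The product of \<open>(s + i - 1) d_i\<close> over
  \<open>i\<close> is \<open>r! binom(s + r - 1, r) d_1 ... d_r\<close>, that is \<open>r!\<close>
  times the multiplicity, in whatever order the degrees are listed; so each \<open>m_i\<close> and
  each \<open>M_i\<close> only has to be compared with a single factor. The shift used for this is
  the degree \<open>(s - 1) d_1\<close> of \<open>F_1^(s-1)\<close> plus the degree of the Koszul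
  basis vector on the first \<open>i\<close> forms. The factor \<open>F_1^(s-1)\<close> serves on
  two sides: it carries \<open>(F_1, ..., F_r)\<close> into \<open>I^s\<close>, and it turns
  \<open>F_1\<close> into the generator \<open>F_1^s\<close> of an ideal containing
  \<open>I^s\<close>. Nonvanishing survives the homotopy because all entries of both Koszul
  differentials have zero constant term. A unit coordinate in a homogeneous vector then pins down
  the shift. Minimality enters through the sign of the shifts: the minima are nonnegative, so the
  lower inequalities may be multiplied.\<close>

interpretation ideal: Modules.module "(*) :: 'a::comm_ring_1 \<Rightarrow> 'a \<Rightarrow> 'a"
  by (rule module_times)

declare ideal.scale_scale [simp del]

text \<open>Properness is kept separate: modulo the unit ideal every element qualifies, which
  settles the zeroth powers in later inductions.\<close>

definition nzd :: "'a::comm_ring_1 set \<Rightarrow> 'a \<Rightarrow> bool"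
  where "nzd A f \<longleftrightarrow> (\<forall>g. f * g \<in> ideal_gen A \<longrightarrow> g \<in> ideal_gen A)"

lemma nzdD: "nzd A f \<Longrightarrow> f * g \<in> ideal_gen A \<Longrightarrow> g \<in> ideal_gen A"
  by (simp add: nzd_def)

lemma nzd_power: "nzd A f \<Longrightarrow> nzd A (f ^ n)"
proof (induction n)
  case (Suc n)
  then show ?case unfolding nzd_def power_Suc mult.assoc by blast
qed (simp add: nzd_def)

lemma ideal_gen_mult: "x \<in> ideal_gen A \<Longrightarrow> c * x \<in> ideal_gen A"
  by (rule ideal.span_scale)

lemma ideal_gen_mult_right: "x \<in> ideal_gen A \<Longrightarrow> x * c \<in> ideal_gen A"
  using ideal.span_scale[of x A c] by (simp add: mult.commute)

lemma ideal_gen_subsetI: "A \<subseteq> ideal_gen B \<Longrightarrow> ideal_gen A \<subseteq> ideal_gen B"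
  using ideal.span_minimal[of A "ideal_gen B"] by simp

lemma ideal_gen_insert_iff: "x \<in> ideal_gen (insert f A) \<longleftrightarrow> (\<exists>h. x - f * h \<in> ideal_gen A)"
  by (simp add: ideal.span_insert mult.commute)

lemma ideal_gen_eq_UNIV_iff: "ideal_gen A = UNIV \<longleftrightarrow> 1 \<in> ideal_gen A"
proof
  assume "1 \<in> ideal_gen A"
  then have "x * 1 \<in> ideal_gen A" for x by (rule ideal_gen_mult)
  then show "ideal_gen A = UNIV" by auto
qed auto

text \<open>One half of exchanging two neighbours of a regular sequence, valid in any commutative
  ring. The other half, regularity of \<open>g\<close> modulo \<open>A\<close> alone, uses the
  grading: see \<open>nzd_homog_descend\<close>.\<close>

lemma nzd_insert_swap:
  assumes "nzd A f" "nzd (insert f A) g"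
  shows "nzd (insert g A) f"
  unfolding nzd_def
proof safe
  fix x assume "f * x \<in> ideal_gen (insert g A)"
  then obtain h where h: "f * x - g * h \<in> ideal_gen A" by (auto simp: ideal_gen_insert_iff)
  have "g * h - f * x \<in> ideal_gen A"
    using ideal.span_neg[OF h] by simp
  then have "g * h \<in> ideal_gen (insert f A)" by (auto simp: ideal_gen_insert_iff)
  then have "h \<in> ideal_gen (insert f A)" using assms(2) by (rule nzdD[rotated])
  then obtain k where k: "h - f * k \<in> ideal_gen A" by (auto simp: ideal_gen_insert_iff)
  have "f * x - g * h + g * (h - f * k) \<in> ideal_gen A"
    by (intro ideal.span_add h ideal_gen_mult k)
  then have "f * (x - g * k) \<in> ideal_gen A" by (simp add: algebra_simps)
  then have "x - g * k \<in> ideal_gen A" using assms(1) by (rule nzdD[rotated])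
  then show "x \<in> ideal_gen (insert g A)" by (auto simp: ideal_gen_insert_iff)
qed

fun reg_seq :: "'a::comm_ring_1 set \<Rightarrow> 'a list \<Rightarrow> bool" where
  "reg_seq A [] \<longleftrightarrow> True"
| "reg_seq A (f # fs) \<longleftrightarrow> nzd A f \<and> reg_seq (insert f A) fs"

lemma reg_seq_append: "reg_seq A (fs @ gs) \<longleftrightarrow> reg_seq A fs \<and> reg_seq (set fs \<union> A) gs"
  by (induction fs arbitrary: A) auto

lemma reg_seq_iff_nth:
  "reg_seq A fs \<longleftrightarrow> (\<forall>i<length fs. nzd (set (take i fs) \<union> A) (fs ! i))"
proof (induction fs arbitrary: A)
  case (Cons f fs)
  then show ?case by (simp add: All_less_Suc2)
qed simp

definition perm_reg_seq :: "'a::comm_ring_1 set \<Rightarrow> 'a list \<Rightarrow> bool"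
  where "perm_reg_seq A fs \<longleftrightarrow> (\<forall>gs. mset gs = mset fs \<longrightarrow> reg_seq A gs)"

lemma perm_reg_seq_cong: "mset fs = mset gs \<Longrightarrow> perm_reg_seq A fs \<longleftrightarrow> perm_reg_seq A gs"
  by (simp add: perm_reg_seq_def)

lemma perm_reg_seq_imp: "perm_reg_seq A fs \<Longrightarrow> mset gs = mset fs \<Longrightarrow> reg_seq A gs"
  by (simp add: perm_reg_seq_def)

lemma perm_reg_seq_nzd: "perm_reg_seq A (f # fs) \<Longrightarrow> nzd A f"
  using perm_reg_seq_imp[of A "f # fs" "f # fs"] by simp

lemma perm_reg_seq_insert: "perm_reg_seq A (f # fs) \<Longrightarrow> perm_reg_seq (insert f A) fs"
  unfolding perm_reg_seq_def by (metis mset.simps(2) reg_seq.simps(2))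

lemma perm_reg_seq_tl:
  assumes "perm_reg_seq A (f # fs)"
  shows "perm_reg_seq A fs"
  unfolding perm_reg_seq_def
proof safe
  fix gs assume "mset gs = mset fs"
  then have "mset (gs @ [f]) = mset (f # fs)" by simp
  then have "reg_seq A (gs @ [f])" using assms unfolding perm_reg_seq_def by blast
  then show "reg_seq A gs" by (simp add: reg_seq_append)
qed

lemma perm_reg_seq_nzd_last:
  assumes "perm_reg_seq {} (f # fs)"
  shows "nzd (set fs) f"
proof -
  have "reg_seq {} (fs @ [f])" by (rule perm_reg_seq_imp[OF assms]) simp
  then show ?thesis by (simp add: reg_seq_append)
qed

section \<open>Powers of ideals\<close>

fun prod_gens :: "'a::comm_ring_1 set \<Rightarrow> nat \<Rightarrow> 'a set" where
  "prod_gens T 0 = {1}"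
| "prod_gens T (Suc s) = {t * x | t x. t \<in> T \<and> x \<in> prod_gens T s}"

lemma prod_gens_mono: "S \<subseteq> T \<Longrightarrow> prod_gens S s \<subseteq> prod_gens T s"
  by (induction s) auto

lemma prod_gens_one [simp]: "prod_gens T (Suc 0) = T"
  by auto

lemma prod_gens_insert:
  "x \<in> prod_gens (insert t T) (Suc s) \<Longrightarrow>
    (\<exists>z\<in>prod_gens (insert t T) s. x = t * z) \<or> x \<in> prod_gens T (Suc s)"
proof (induction s arbitrary: x)
  case (Suc s)
  then obtain a y where ay: "x = a * y" "a = t \<or> a \<in> T" "y \<in> prod_gens (insert t T) (Suc s)"
    by auto
  show ?case
  proof (cases "a = t")
    case False
    then have a: "a \<in> T" using ay by auto
    from Suc.IH[OF ay(3)] show ?thesis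
    proof
      assume "\<exists>z\<in>prod_gens (insert t T) s. y = t * z"
      then obtain z where z: "z \<in> prod_gens (insert t T) s" "y = t * z" by auto
      have "a * z \<in> prod_gens (insert t T) (Suc s)" using a z by auto
      then show ?thesis using ay z by (metis mult.left_commute)
    next
      assume "y \<in> prod_gens T (Suc s)"
      then show ?thesis using a ay by auto
    qed
  qed (use ay in auto)
qed auto

lemma prod_gens_in_ideal_pred:
  "prod_gens T (Suc s) \<subseteq> ideal_gen (prod_gens T s)"
  by (auto intro: ideal_gen_mult ideal.span_base)

lemma prod_gens_mult_mem:
  assumes "t \<in> T" "x \<in> ideal_gen (prod_gens T s)"
  shows "t * x \<in> ideal_gen (prod_gens T (Suc s))"
  using assms(2)
proof (induction rule: ideal.span_induct_alt)
  case base
  then show ?case by (simp add: ideal.span_zero)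
next
  case (step c x y)
  have "t * x \<in> ideal_gen (prod_gens T (Suc s))"
    using assms(1) step by (intro ideal.span_base) auto
  then have "c * (t * x) + t * y \<in> ideal_gen (prod_gens T (Suc s))"
    by (rule ideal.span_add[OF ideal_gen_mult step(2)])
  then show ?case by (simp add: algebra_simps)
qed

lemma prod_gens_insert_decompose:
  assumes "x \<in> ideal_gen (A \<union> prod_gens (insert t T) (Suc s))"
  shows "\<exists>h\<in>ideal_gen (prod_gens (insert t T) s). x - t * h \<in> ideal_gen (A \<union> prod_gens T (Suc s))"
  using assms
proof (induction rule: ideal.span_induct_alt)
  case base
  then show ?case by (intro bexI[of _ 0]) (auto simp: ideal.span_zero)
next
  case (step c x y)
  then obtain h where h: "h \<in> ideal_gen (prod_gens (insert t T) s)"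
    "y - t * h \<in> ideal_gen (A \<union> prod_gens T (Suc s))" by auto
  consider "x \<in> A \<union> prod_gens T (Suc s)" | z where "z\<in>prod_gens (insert t T) s" "x = t * z"
    using step(1) prod_gens_insert by blast
  then show ?case
  proof cases
    case 1
    have "c * x + (y - t * h) \<in> ideal_gen (A \<union> prod_gens T (Suc s))"
      by (intro ideal.span_add ideal_gen_mult h ideal.span_base 1)
    then show ?thesis using h(1) by (auto simp: algebra_simps)
  next
    case 2
    have "c * z + h \<in> ideal_gen (prod_gens (insert t T) s)"
      by (intro ideal.span_add ideal_gen_mult h ideal.span_base 2)
    then show ?thesis using h(2) 2 by (intro bexI[of _ "c * z + h"]) (auto simp: algebra_simps)
  qed
qed

lemma ideal_gen_Un_mono:
  "B \<subseteq> ideal_gen (A \<union> C) \<Longrightarrow> ideal_gen (A \<union> B) \<subseteq> ideal_gen (A \<union> C)"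
  by (intro ideal_gen_subsetI) (auto intro: ideal.span_base)

lemma ideal_gen_Un_prod_gens_Suc:
  "ideal_gen (A \<union> prod_gens T (Suc s)) \<subseteq> ideal_gen (A \<union> prod_gens T s)"
  using prod_gens_in_ideal_pred[of T s] ideal.span_mono[of "prod_gens T s" "A \<union> prod_gens T s"]
  by (intro ideal_gen_Un_mono) auto

lemma prod_gens_mult_mem_Un:
  assumes "t \<in> T" "x \<in> ideal_gen (A \<union> prod_gens T s)"
  shows "t * x \<in> ideal_gen (A \<union> prod_gens T (Suc s))"
proof -
  obtain a b where ab: "x = a + b" "a \<in> ideal_gen A" "b \<in> ideal_gen (prod_gens T s)"
    using assms(2) by (auto simp: ideal.span_Un)
  show ?thesis unfolding ideal.span_Un ab(1) distrib_left
    using ideal_gen_mult[OF ab(2), of t] prod_gens_mult_mem[OF assms(1) ab(3)] by blast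
qed

text \<open>Products containing \<open>t\<close> are split off: \<open>t * g = t * h\<close> modulo
  \<open>A\<close> and the power \<open>s + 1\<close> of \<open>T\<close>, with \<open>h\<close> in
  the power \<open>s\<close> of \<open>(t, T)\<close>. Cancelling \<open>t\<close> leaves
  \<open>g - h\<close> in an ideal already contained in the target.\<close>

lemma nzd_prod_gens_imp_colon:
  assumes "nzd (A \<union> prod_gens T (Suc s)) t" "t * g \<in> ideal_gen (A \<union> prod_gens (insert t T) (Suc s))"
  shows "g \<in> ideal_gen (A \<union> prod_gens (insert t T) s)"
proof -
  obtain h where h: "h \<in> ideal_gen (prod_gens (insert t T) s)"
    "t * g - t * h \<in> ideal_gen (A \<union> prod_gens T (Suc s))"
    using prod_gens_insert_decompose[OF assms(2)] by auto
  then have "t * (g - h) \<in> ideal_gen (A \<union> prod_gens T (Suc s))" by (simp add: algebra_simps)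
  then have "g - h \<in> ideal_gen (A \<union> prod_gens T (Suc s))" using assms(1) by (rule nzdD[rotated])
  also have "\<dots> \<subseteq> ideal_gen (A \<union> prod_gens T s)" by (rule ideal_gen_Un_prod_gens_Suc)
  also have "\<dots> \<subseteq> ideal_gen (A \<union> prod_gens (insert t T) s)"
    by (intro ideal.span_mono Un_mono prod_gens_mono order_refl subset_insertI)
  finally have "g - h \<in> ideal_gen (A \<union> prod_gens (insert t T) s)" .
  moreover have "h \<in> ideal_gen (A \<union> prod_gens (insert t T) s)"
    using h(1) ideal.span_mono[of "prod_gens (insert t T) s" "A \<union> prod_gens (insert t T) s"] by auto
  ultimately have "(g - h) + h \<in> ideal_gen (A \<union> prod_gens (insert t T) s)" by (rule ideal.span_add)
  then show ?thesis by simp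
qed

text \<open>Induction on the list, then on \<open>s\<close>. Modulo \<open>t\<close> only the power
  of \<open>T\<close> remains, so the outer hypothesis gives \<open>g = t * k\<close> up to an
  element of the ideal; the colon by \<open>t\<close> then turns \<open>t * (f * k)\<close> into
  \<open>f * k\<close> with exponent \<open>s\<close>, where the inner hypothesis cancels
  \<open>f\<close>.\<close>

lemma nzd_prod_gens:
  "perm_reg_seq A (f # T) \<Longrightarrow> nzd (A \<union> prod_gens (set T) s) f"
proof (induction T arbitrary: A f s)
  case Nil
  show ?case
  proof (cases s)
    case 0
    then show ?thesis
      using ideal_gen_eq_UNIV_iff[of "A \<union> {1}"] by (auto simp: nzd_def intro: ideal.span_base)
  next
    case (Suc m)
    then show ?thesis using Nil by (simp add: perm_reg_seq_nzd)
  qed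
next
  case (Cons t T)
  have perm: "perm_reg_seq A (t # f # T)"
    using Cons.prems by (subst perm_reg_seq_cong[of _ "f # t # T"]) auto
  \<comment> \<open>The outer hypothesis, applied with \<open>t\<close> in the role of
    \<open>f\<close>, makes the colon by \<open>t\<close> available.\<close>
  have colon: "nzd (A \<union> prod_gens (set T) n) t" for n
    using Cons.prems perm_reg_seq_tl by (intro Cons.IH) blast
  have mod_t: "nzd (insert t A \<union> prod_gens (set T) n) f" for n
    using perm by (intro Cons.IH perm_reg_seq_insert)
  show ?case
  proof (induction s)
    case 0
    then show ?case
      using ideal_gen_eq_UNIV_iff[of "A \<union> {1}"] by (auto simp: nzd_def intro: ideal.span_base)
  next
    case (Suc s)
    let ?E = "\<lambda>s. ideal_gen (A \<union> prod_gens (set (t # T)) s)"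
    show ?case unfolding nzd_def
    proof safe
      fix g assume g: "f * g \<in> ?E (Suc s)"
      obtain h where "f * g - t * h \<in> ideal_gen (A \<union> prod_gens (set T) (Suc s))"
        using prod_gens_insert_decompose[of "f * g" A t "set T" s] g by auto
      then have "f * g \<in> ideal_gen (insert t A \<union> prod_gens (set T) (Suc s))"
        unfolding Un_insert_left ideal_gen_insert_iff by blast
      then have "g \<in> ideal_gen (insert t A \<union> prod_gens (set T) (Suc s))"
        using mod_t by (rule nzdD[rotated])
      then obtain k where k: "g - t * k \<in> ideal_gen (A \<union> prod_gens (set T) (Suc s))"
        unfolding Un_insert_left ideal_gen_insert_iff by blast
      moreover have "ideal_gen (A \<union> prod_gens (set T) (Suc s)) \<subseteq> ?E (Suc s)"
        by (intro ideal.span_mono Un_mono prod_gens_mono order_refl) auto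
      ultimately have gE: "g - t * k \<in> ?E (Suc s)" by blast
      have "f * g - f * (g - t * k) \<in> ?E (Suc s)"
        by (intro ideal.span_diff g ideal_gen_mult gE)
      then have "t * (f * k) \<in> ?E (Suc s)" by (simp add: algebra_simps)
      then have "f * k \<in> ?E s"
        using nzd_prod_gens_imp_colon[OF colon] by simp
      then have "k \<in> ?E s" using Suc.IH by (rule nzdD[rotated])
      then have "t * k \<in> ?E (Suc s)" by (rule prod_gens_mult_mem_Un[rotated]) simp
      then have "(g - t * k) + t * k \<in> ?E (Suc s)" by (intro ideal.span_add gE)
      then show "g \<in> ?E (Suc s)" by simp
    qed
  qed
qed

text \<open>Identifies the kernel side of multiplication by \<open>t\<close>;
  \<open>ideal_gen_insert_prod_gens\<close> identifies the cokernel. Together they drive the Pascal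
  recursion for multiplicities.\<close>

lemma prod_gens_colon:
  assumes "perm_reg_seq A (t # T)"
  shows "t * g \<in> ideal_gen (A \<union> prod_gens (set (t # T)) (Suc s)) \<longleftrightarrow>
    g \<in> ideal_gen (A \<union> prod_gens (set (t # T)) s)"
  using nzd_prod_gens_imp_colon[OF nzd_prod_gens[OF assms]]
    prod_gens_mult_mem_Un[of t "set (t # T)"] by auto

lemma ideal_gen_insert_prod_gens:
  "ideal_gen (insert t (A \<union> prod_gens (insert t T) (Suc s))) =
    ideal_gen (insert t A \<union> prod_gens T (Suc s))"
proof
  have "x \<in> ideal_gen (insert t A \<union> prod_gens T (Suc s))"
    if "x \<in> prod_gens (insert t T) (Suc s)" for x
    using prod_gens_insert[OF that]
    by (auto intro: ideal.span_base ideal_gen_mult_right)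
  then show "ideal_gen (insert t (A \<union> prod_gens (insert t T) (Suc s))) \<subseteq>
    ideal_gen (insert t A \<union> prod_gens T (Suc s))"
    by (intro ideal_gen_subsetI) (auto intro: ideal.span_base)
  show "ideal_gen (insert t A \<union> prod_gens T (Suc s)) \<subseteq>
    ideal_gen (insert t (A \<union> prod_gens (insert t T) (Suc s)))"
    using prod_gens_mono[of T "insert t T" "Suc s"] by (intro ideal.span_mono) auto
qed

lemma ideal_power_ideal_gen: "ideal_power (ideal_gen T) s = ideal_gen (prod_gens T s)"
proof
  have "(\<Prod>i<s. f i) \<in> ideal_gen (prod_gens T s)" if "\<forall>i<s. f i \<in> ideal_gen T" for f
    using that
  proof (induction s)
    case (Suc s)
    then have IH: "(\<Prod>i<s. f i) \<in> ideal_gen (prod_gens T s)" by simp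
    have "f s \<in> ideal_gen T" using Suc.prems by simp
    then have "(\<Prod>i<s. f i) * f s \<in> ideal_gen (prod_gens T (Suc s))"
    proof (induction rule: ideal.span_induct_alt)
      case base
      then show ?case by (simp add: ideal.span_zero)
    next
      case (step c x y)
      have "c * (x * (\<Prod>i<s. f i)) + (\<Prod>i<s. f i) * y \<in> ideal_gen (prod_gens T (Suc s))"
        by (intro ideal.span_add ideal_gen_mult prod_gens_mult_mem IH step)
      then show ?case by (simp add: algebra_simps)
    qed
    then show ?case by simp
  qed (simp add: ideal.span_base)
  then show "ideal_power (ideal_gen T) s \<subseteq> ideal_gen (prod_gens T s)"
    unfolding ideal_power_def by (intro ideal_gen_subsetI) auto
  have "\<exists>f. (\<forall>i<s. f i \<in> ideal_gen T) \<and> x = (\<Prod>i<s. f i)" if "x \<in> prod_gens T s" for x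
    using that
  proof (induction s arbitrary: x)
    case (Suc s)
    then obtain t y where ty: "x = t * y" "t \<in> T" "y \<in> prod_gens T s" by auto
    from Suc.IH[OF ty(3)] obtain f where f: "\<forall>i<s. f i \<in> ideal_gen T" "y = (\<Prod>i<s. f i)"
      by auto
    show ?case
      using f ty by (intro exI[of _ "f(s := t)"]) (auto simp: less_Suc_eq mult.commute intro: ideal.span_base)
  qed simp
  then show "ideal_gen (prod_gens T s) \<subseteq> ideal_power (ideal_gen T) s"
    unfolding ideal_power_def by (intro ideal.span_mono) blast
qed

section \<open>Koszul complexes\<close>

text \<open>
  The Koszul complex on \<open>fs\<close> is realised on coefficient functions on words: a word \<open>w\<close> of bits of
  length \<open>length fs\<close> encodes the exterior basis vector indexed by the positions of \<open>True\<close>. The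
  recursion on \<open>fs\<close> is the mapping cone of multiplication by the head, which takes care of all signs.
  \<open>koszul_bd\<close> is the boundary map on coefficient functions, and \<open>koszul_comb\<close> is its transpose: for
  a family \<open>u\<close> it is the combination of the values of \<open>u\<close> prescribed by the boundary of the basis
  vector \<open>w\<close>.
\<close>

definition weight :: "bool list \<Rightarrow> nat"
  where "weight w = length (filter id w)"

lemma weight_simps [simp]:
  "weight [] = 0" "weight (True # w) = Suc (weight w)" "weight (False # w) = weight w"
  by (simp_all add: weight_def)

lemma weight_le_length: "weight w \<le> length w"
  by (simp add: weight_def)

lemma weight_eq_0_iff: "weight w = 0 \<longleftrightarrow> w = replicate (length w) False"
proof (induction w)
  case (Cons b w)
  then show ?case by (cases b) auto
qed auto

lemma weight_replicate_False [simp]: "weight (replicate m False) = 0"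
  by (simp add: weight_def)

fun koszul_bd :: "'a::comm_ring_1 list \<Rightarrow> (bool list \<Rightarrow> 'a) \<Rightarrow> bool list \<Rightarrow> 'a" where
  "koszul_bd [] a w = 0"
| "koszul_bd (f # fs) a [] = 0"
| "koszul_bd (f # fs) a (True # w) = - koszul_bd fs (\<lambda>v. a (True # v)) w"
| "koszul_bd (f # fs) a (False # w) = koszul_bd fs (\<lambda>v. a (False # v)) w + f * a (True # w)"

fun koszul_comb :: "'a::comm_ring_1 list \<Rightarrow> (bool list \<Rightarrow> 'a) \<Rightarrow> bool list \<Rightarrow> 'a" where
  "koszul_comb [] u w = 0"
| "koszul_comb (f # fs) u [] = 0"
| "koszul_comb (f # fs) u (True # w) = f * u (False # w) - koszul_comb fs (\<lambda>v. u (True # v)) w"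
| "koszul_comb (f # fs) u (False # w) = koszul_comb fs (\<lambda>v. u (False # v)) w"

lemma koszul_bd_add: "koszul_bd fs (\<lambda>v. a v + b v) w = koszul_bd fs a w + koszul_bd fs b w"
  by (induction fs a w arbitrary: b rule: koszul_bd.induct) (simp_all, simp_all add: algebra_simps)

lemma koszul_bd_scale: "koszul_bd fs (\<lambda>v. c * a v) w = c * koszul_bd fs a w"
  by (induction fs a w rule: koszul_bd.induct) (auto simp: algebra_simps)

lemma koszul_bd_zero [simp]: "koszul_bd fs (\<lambda>v. 0) w = 0"
  using koszul_bd_scale[of fs 0 "\<lambda>_. 0" w] by simp

lemma koszul_bd_uminus: "koszul_bd fs (\<lambda>v. - a v) w = - koszul_bd fs a w"
  using koszul_bd_scale[of fs "-1" a w] by simp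

lemma koszul_bd_diff: "koszul_bd fs (\<lambda>v. a v - b v) w = koszul_bd fs a w - koszul_bd fs b w"
  using koszul_bd_add[of fs a "\<lambda>v. - b v" w] by (simp add: koszul_bd_uminus)

lemma koszul_comb_add:
  "koszul_comb fs (\<lambda>v. a v + b v) w = koszul_comb fs a w + koszul_comb fs b w"
  by (induction fs a w arbitrary: b rule: koszul_comb.induct) (simp_all, simp_all add: algebra_simps)

lemma koszul_comb_scale: "koszul_comb fs (\<lambda>v. c * a v) w = c * koszul_comb fs a w"
  by (induction fs a w rule: koszul_comb.induct) (auto simp: algebra_simps)

lemma koszul_comb_zero [simp]: "koszul_comb fs (\<lambda>v. 0) w = 0"
  using koszul_comb_scale[of fs 0 "\<lambda>_. 0" w] by simp

lemma koszul_comb_uminus: "koszul_comb fs (\<lambda>v. - a v) w = - koszul_comb fs a w"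
  using koszul_comb_scale[of fs "-1" a w] by simp

lemma koszul_comb_diff:
  "koszul_comb fs (\<lambda>v. a v - b v) w = koszul_comb fs a w - koszul_comb fs b w"
  using koszul_comb_add[of fs a "\<lambda>v. - b v" w] by (simp add: koszul_comb_uminus)

lemma koszul_comb_cong:
  assumes "\<And>v. length v = length w \<Longrightarrow> Suc (weight v) = weight w \<Longrightarrow> a v = b v"
  shows "koszul_comb fs a w = koszul_comb fs b w"
  using assms
proof (induction fs a w arbitrary: b rule: koszul_comb.induct)
  case (3 f fs u w)
  then show ?case by (auto intro!: arg_cong2[where f = "(-)"] "3.IH")
next
  case (4 f fs u w)
  then show ?case by (auto intro!: "4.IH")
qed auto

lemma koszul_comb_weight_0: "weight w = 0 \<Longrightarrow> koszul_comb fs u w = 0"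
  using koszul_comb_cong[of w u "\<lambda>_. 0" fs] by simp

text \<open>The relation \<open>d d = 0\<close> of the Koszul complex in transposed form.\<close>

lemma koszul_comb_koszul_comb: "koszul_comb fs (koszul_comb fs u) w = 0"
proof (induction fs u w rule: koszul_comb.induct)
  case (3 f fs u w)
  then show ?case by (simp add: koszul_comb_diff koszul_comb_scale)
qed auto

lemma koszul_bd_mem: "koszul_bd fs a w \<in> ideal_gen (set fs)"
proof (induction fs a w rule: koszul_bd.induct)
  case (3 f fs a w)
  then show ?case
    using ideal.span_mono[of "set fs" "set (f # fs)"] by (auto intro: ideal.span_neg)
next
  case (4 f fs a w)
  have "koszul_bd fs (\<lambda>v. a (False # v)) w \<in> ideal_gen (set (f # fs))"
    using 4 ideal.span_mono[of "set fs" "set (f # fs)"] by auto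
  then show ?case by (auto intro: ideal.span_add ideal_gen_mult_right ideal.span_base)
qed (simp_all add: ideal.span_zero)

lemma koszul_comb_mem: "koszul_comb fs a w \<in> ideal_gen (set fs)"
proof (induction fs a w rule: koszul_comb.induct)
  case (3 f fs a w)
  have "koszul_comb fs (\<lambda>v. a (True # v)) w \<in> ideal_gen (set (f # fs))"
    using 3 ideal.span_mono[of "set fs" "set (f # fs)"] by auto
  then show ?case by (auto intro: ideal.span_diff ideal_gen_mult_right ideal.span_base)
next
  case (4 f fs a w)
  then show ?case using ideal.span_mono[of "set fs" "set (f # fs)"] by auto
qed (simp_all add: ideal.span_zero)

section \<open>Linear operators and families built along the Koszul boundary\<close>

definition linear_op :: "(('i \<Rightarrow> 'a::comm_ring_1) \<Rightarrow> 'j \<Rightarrow> 'a) \<Rightarrow> bool" where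
  "linear_op L \<longleftrightarrow> (\<forall>x y. L (\<lambda>i. x i + y i) = (\<lambda>j. L x j + L y j)) \<and>
    (\<forall>c x. L (\<lambda>i. c * x i) = (\<lambda>j. c * L x j))"

lemma linear_op_add: "linear_op L \<Longrightarrow> L (\<lambda>i. x i + y i) = (\<lambda>j. L x j + L y j)"
  and linear_op_scale: "linear_op L \<Longrightarrow> L (\<lambda>i. c * x i) = (\<lambda>j. c * L x j)"
  by (auto simp: linear_op_def)

lemma linear_op_zero: "linear_op L \<Longrightarrow> L (\<lambda>i. 0) = (\<lambda>j. 0)"
  using linear_op_scale[of L 0 "\<lambda>_. 0"] by simp

lemma linear_op_diff:
  assumes "linear_op L"
  shows "L (\<lambda>i. x i - y i) = (\<lambda>j. L x j - L y j)"
  using linear_op_add[OF assms, of x "\<lambda>i. - 1 * y i"] linear_op_scale[OF assms, of "-1" y] by simp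

lemma linear_op_sum:
  assumes "linear_op L"
  shows "L (\<lambda>i. \<Sum>l\<in>A. c l * x l i) = (\<lambda>j. \<Sum>l\<in>A. c l * L (x l) j)"
  by (induction A rule: infinite_finite_induct)
    (auto simp: linear_op_zero[OF assms] linear_op_add[OF assms] linear_op_scale[OF assms])

lemma linear_op_koszul_bd: "linear_op (koszul_bd fs)"
  by (auto simp: linear_op_def koszul_bd_add koszul_bd_scale)

text \<open>\<open>koszul_comb\<close> acts on the word index and \<open>L\<close> on the coordinate
  index, so the two commute.\<close>

lemma linear_op_koszul_comb:
  assumes "linear_op L"
  shows "L (\<lambda>i. koszul_comb fs (\<lambda>w. u w i) w) = (\<lambda>j. koszul_comb fs (\<lambda>w. L (u w) j) w)"
proof (induction fs arbitrary: u w)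
  case (Cons f fs)
  show ?case
  proof (cases w)
    case (Cons b w')
    then show ?thesis
      by (cases b) (auto simp: linear_op_diff[OF assms] linear_op_scale[OF assms] Cons.IH)
  qed (simp add: linear_op_zero[OF assms])
qed (simp add: linear_op_zero[OF assms])

text \<open>The common recursion behind chain maps and homotopies on a Koszul complex. The value at
  \<open>w\<close> is constrained only by the values on the boundary of \<open>w\<close>, which by
  \<open>koszul_comb_cong\<close> have weight one less, so values can be chosen weight by
  weight.\<close>

lemma koszul_comb_family_exists:
  assumes step: "\<And>w h. length w = m \<Longrightarrow>
      (\<And>v. length v = m \<Longrightarrow> Suc (weight v) = weight w \<Longrightarrow> Q v (h v) (\<lambda>i. koszul_comb fs (\<lambda>w. h w i) v)) \<Longrightarrow>
      \<exists>y. Q w y (\<lambda>i. koszul_comb fs (\<lambda>w. h w i) w)"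
  shows "\<exists>h. \<forall>w. length w = m \<longrightarrow> Q w (h w) (\<lambda>i. koszul_comb fs (\<lambda>w. h w i) w)"
proof -
  have "\<exists>h. \<forall>w. length w = m \<longrightarrow> weight w < n \<longrightarrow> Q w (h w) (\<lambda>i. koszul_comb fs (\<lambda>w. h w i) w)" for n
  proof (induction n)
    case (Suc n)
    then obtain h where h: "\<And>w. length w = m \<Longrightarrow> weight w < n \<Longrightarrow> Q w (h w) (\<lambda>i. koszul_comb fs (\<lambda>w. h w i) w)"
      by auto
    have "\<exists>y. Q w y (\<lambda>i. koszul_comb fs (\<lambda>w. h w i) w)" if "length w = m" "weight w = n" for w
      by (rule step) (use that in \<open>auto intro: h\<close>)
    then obtain y where y: "\<And>w. length w = m \<Longrightarrow> weight w = n \<Longrightarrow> Q w (y w) (\<lambda>i. koszul_comb fs (\<lambda>w. h w i) w)"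
      by metis
    define h' where "h' = (\<lambda>w. if weight w = n then y w else h w)"
    have eq: "koszul_comb fs (\<lambda>w. h' w i) w = koszul_comb fs (\<lambda>w. h w i) w" if "weight w \<le> n" for i w
      using that by (intro koszul_comb_cong) (auto simp: h'_def)
    have "Q w (h' w) (\<lambda>i. koszul_comb fs (\<lambda>w. h' w i) w)" if "length w = m" "weight w < Suc n" for w
      using that h[of w] y[of w] by (auto simp: eq) (auto simp: h'_def)
    then show ?case by blast
  qed simp
  from this[of "Suc m"] obtain h where
    "\<And>w. length w = m \<Longrightarrow> weight w < Suc m \<Longrightarrow> Q w (h w) (\<lambda>i. koszul_comb fs (\<lambda>w. h w i) w)"
    by auto
  moreover have "weight w < Suc m" if "length w = m" for w
    using weight_le_length[of w] that by simp
  ultimately show ?thesis by blast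
qed

definition koszul_chains :: "nat \<Rightarrow> nat \<Rightarrow> (bool list \<Rightarrow> 'a::comm_ring_1) set" where
  "koszul_chains m p = {a. \<forall>w. a w \<noteq> 0 \<longrightarrow> length w = m \<and> weight w = p}"

lemma koszul_chainsD:
  "a \<in> koszul_chains m p \<Longrightarrow> a w \<noteq> 0 \<Longrightarrow> length w = m \<and> weight w = p"
  by (simp add: koszul_chains_def)

lemma koszul_chains_diff:
  assumes "a \<in> koszul_chains m p" "b \<in> koszul_chains m p"
  shows "(\<lambda>w. a w - b w) \<in> koszul_chains m p"
  unfolding koszul_chains_def
proof (intro CollectI allI impI)
  fix w assume "a w - b w \<noteq> 0"
  then have "a w \<noteq> 0 \<or> b w \<noteq> 0" by auto
  then show "length w = m \<and> weight w = p" using assms[THEN koszul_chainsD] by blast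
qed

lemma koszul_chains_zero: "(\<lambda>w. 0) \<in> koszul_chains m p"
  by (simp add: koszul_chains_def)

lemma koszul_chains_sum:
  assumes "\<And>l. l \<in> A \<Longrightarrow> x l \<in> koszul_chains m p"
  shows "(\<lambda>w. \<Sum>l\<in>A. c l * x l w) \<in> koszul_chains m p"
  unfolding koszul_chains_def
proof safe
  fix w assume "(\<Sum>l\<in>A. c l * x l w) \<noteq> 0"
  then obtain l where "l \<in> A" "c l * x l w \<noteq> 0" by (meson sum.neutral)
  then have "x l w \<noteq> 0" by auto
  then show "length w = m" "weight w = p"
    using assms[OF \<open>l \<in> A\<close>] by (auto simp: koszul_chains_def)
qed

text \<open>Since \<open>p - 1\<close> is truncated at 0, the vanishing of the \<open>True\<close>
  part for \<open>p = 0\<close> is recorded separately.\<close>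

lemma koszul_chains_Cons:
  assumes "a \<in> koszul_chains (Suc m) p"
  shows "(\<lambda>v. a (False # v)) \<in> koszul_chains m p"
    and "(\<lambda>v. a (True # v)) \<in> koszul_chains m (p - 1)"
    and "p = 0 \<Longrightarrow> a (True # v) = 0"
    and "a [] = 0"
proof -
  note * = koszul_chainsD[OF assms]
  show "(\<lambda>v. a (False # v)) \<in> koszul_chains m p" "(\<lambda>v. a (True # v)) \<in> koszul_chains m (p - 1)"
    using *[of "False # _"] *[of "True # _"] by (fastforce simp: koszul_chains_def)+
  show "p = 0 \<Longrightarrow> a (True # v) = 0" "a [] = 0"
    using *[of "True # v"] *[of "[]"] by auto
qed

lemma koszul_bd_weight_0:
  "a \<in> koszul_chains (length fs) 0 \<Longrightarrow> koszul_bd fs a w = 0"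
proof (induction fs a w rule: koszul_bd.induct)
  case (3 f fs a w)
  have "(\<lambda>v. a (True # v)) = (\<lambda>_. 0)"
    using koszul_chainsD[OF "3.prems"] by fastforce
  then show ?case by simp
next
  case (4 f fs a w)
  have "a (True # w) = 0" "(\<lambda>v. a (False # v)) \<in> koszul_chains (length fs) 0"
    using 4 by (auto simp: koszul_chains_def)
  then show ?case using 4 by simp
qed auto

lemma koszul_bd_chains:
  "a \<in> koszul_chains (length fs) (Suc p) \<Longrightarrow> koszul_bd fs a \<in> koszul_chains (length fs) p"
proof (induction fs arbitrary: a p)
  case (Cons f fs)
  have F: "(\<lambda>v. a (False # v)) \<in> koszul_chains (length fs) (Suc p)"
    and T: "(\<lambda>v. a (True # v)) \<in> koszul_chains (length fs) p"
    using koszul_chains_Cons[of a "length fs" "Suc p"] Cons.prems by simp_all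
  have "length w = Suc (length fs) \<and> weight w = p" if nz: "koszul_bd (f # fs) a w \<noteq> 0" for w
  proof (cases w)
    case (Cons b v)
    show ?thesis
    proof (cases b)
      case True
      show ?thesis
      proof (cases p)
        case 0
        then show ?thesis using T Cons True nz by (simp add: koszul_bd_weight_0)
      next
        case (Suc q)
        then show ?thesis
          using koszul_chainsD[OF Cons.IH[of "\<lambda>v. a (True # v)" q], of v] T Cons True nz by simp
      qed
    next
      case False
      then have "koszul_bd fs (\<lambda>v. a (False # v)) v \<noteq> 0 \<or> a (True # v) \<noteq> 0"
        using Cons nz by auto
      then show ?thesis
        using koszul_chainsD[OF Cons.IH[OF F], of v] koszul_chainsD[OF T, of v] Cons False by auto
    qed
  qed (use nz in simp)
  then show ?case by (simp add: koszul_chains_def)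
qed (simp add: koszul_chains_def)

text \<open>A regular sequence read from its end: the head is regular modulo the tail, matching the
  mapping cone recursion, in which the head is adjoined last.\<close>

fun koszul_regular :: "'a::comm_ring_1 list \<Rightarrow> bool" where
  "koszul_regular [] \<longleftrightarrow> True"
| "koszul_regular (f # fs) \<longleftrightarrow> nzd (set fs) f \<and> koszul_regular fs"

lemma koszul_regular_if_perm_reg_seq:
  "perm_reg_seq {} fs \<Longrightarrow> koszul_regular fs"
  by (induction fs) (auto intro: perm_reg_seq_nzd_last dest: perm_reg_seq_tl)

text \<open>In degree 0 the complex is augmented by the quotient ring, so that exactness also covers
  the identification of the degree 0 homology.\<close>

definition koszul_cycle :: "'a::comm_ring_1 list \<Rightarrow> nat \<Rightarrow> (bool list \<Rightarrow> 'a) \<Rightarrow> bool" where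
  "koszul_cycle fs p a \<longleftrightarrow> a \<in> koszul_chains (length fs) p \<and>
    (if p = 0 then a (replicate (length fs) False) \<in> ideal_gen (set fs) else \<forall>w. koszul_bd fs a w = 0)"

text \<open>A preimage is sought as a pair of coefficient functions for the two parts of the mapping cone.\<close>

lemma koszul_exact:
  "koszul_regular fs \<Longrightarrow> koszul_cycle fs p a \<Longrightarrow>
    \<exists>b\<in>koszul_chains (length fs) (Suc p). koszul_bd fs b = a"
proof (induction fs arbitrary: a p)
  case Nil
  have "a w = 0" for w
    using Nil.prems(2)
    by (cases "w = []"; cases "p = 0") (auto simp: koszul_cycle_def koszul_chains_def)
  then show ?case by (intro bexI[of _ "\<lambda>_. 0"]) (auto simp: koszul_chains_zero)
next
  case (Cons f fs)
  let ?m = "length fs" and ?o = "replicate (length fs) False"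
  define b where "b = (\<lambda>v. a (False # v))"
  define c where "c = (\<lambda>v. a (True # v))"
  have a: "a \<in> koszul_chains (Suc ?m) p"
    using Cons.prems by (simp add: koszul_cycle_def)
  have b: "b \<in> koszul_chains ?m p" and c: "c \<in> koszul_chains ?m (p - 1)" and c0: "p = 0 \<Longrightarrow> c v = 0" for v
    using koszul_chains_Cons[OF a] by (auto simp: b_def c_def)
  have a_eq: "a w = (case w of [] \<Rightarrow> 0 | x # v \<Rightarrow> if x then c v else b v)" for w
    using koszul_chains_Cons(4)[OF a] by (auto simp: b_def c_def split: list.split)
  have nzd: "nzd (set fs) f" and kr: "koszul_regular fs"
    using Cons.prems by auto
  have "\<exists>b' c'. b' \<in> koszul_chains ?m (Suc p) \<and> c' \<in> koszul_chains ?m p \<and>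
    (\<forall>v. koszul_bd fs b' v + f * c' v = b v) \<and> (\<forall>v. - koszul_bd fs c' v = c v)"
  proof (cases p)
    case 0
    have "b ?o \<in> ideal_gen (set (f # fs))"
      using Cons.prems 0 by (simp add: koszul_cycle_def b_def)
    then obtain h where h: "b ?o - f * h \<in> ideal_gen (set fs)"
      by (auto simp: ideal_gen_insert_iff)
    define c' where "c' = (\<lambda>v. if v = ?o then h else 0)"
    have c': "c' \<in> koszul_chains ?m 0" by (auto simp: c'_def koszul_chains_def)
    have "koszul_cycle fs 0 (\<lambda>v. b v - f * c' v)"
      using h b c' 0
      by (fastforce simp: koszul_cycle_def c'_def koszul_chains_def)
    from Cons.IH[OF kr this] obtain b' where b': "b' \<in> koszul_chains ?m (Suc 0)"
      "koszul_bd fs b' = (\<lambda>v. b v - f * c' v)" by auto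
    show ?thesis
      using b' c' 0 c0 by (intro exI[of _ b'] exI[of _ c']) (auto simp: koszul_bd_weight_0)
  next
    case (Suc q)
    have cyc: "koszul_bd (f # fs) a w = 0" for w
      using Cons.prems Suc by (auto simp: koszul_cycle_def)
    have bdc: "koszul_bd fs c v = 0" and bdb: "koszul_bd fs b v + f * c v = 0" for v
      using cyc[of "True # v"] cyc[of "False # v"] by (simp_all add: b_def c_def)
    \<comment> \<open>This is the cycle condition for \<open>c\<close> when \<open>q = 0\<close>:
      \<open>f * c ?o\<close> is minus a boundary value, hence in the ideal, and \<open>f\<close>
      cancels.\<close>
    have "c ?o \<in> ideal_gen (set fs)"
    proof (rule nzdD[OF nzd])
      have "f * c ?o = - koszul_bd fs b ?o" using bdb[of ?o] by (simp add: eq_neg_iff_add_eq_0 add.commute)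
      then show "f * c ?o \<in> ideal_gen (set fs)" by (simp add: koszul_bd_mem ideal.span_neg)
    qed
    then have "koszul_cycle fs q c" using c Suc bdc by (simp add: koszul_cycle_def)
    from Cons.IH[OF kr this] obtain c' where c': "c' \<in> koszul_chains ?m (Suc q)" "koszul_bd fs c' = c"
      by auto
    have "koszul_cycle fs p (\<lambda>v. b v + f * c' v)"
      unfolding koszul_cycle_def
    proof
      show "(\<lambda>v. b v + f * c' v) \<in> koszul_chains ?m p"
        using koszul_chains_sum[of "{True, False}" "\<lambda>l. if l then b else c'" ?m p "\<lambda>l. if l then 1 else f"]
          b c'(1) Suc by simp
    qed (use c' Suc bdb in \<open>simp add: koszul_bd_add koszul_bd_scale\<close>)
    from Cons.IH[OF kr this] obtain b' where b': "b' \<in> koszul_chains ?m (Suc p)"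
      "koszul_bd fs b' = (\<lambda>v. b v + f * c' v)" by auto
    have "(\<lambda>v. - c' v) \<in> koszul_chains ?m p" using c' Suc by (simp add: koszul_chains_def)
    then show ?thesis using b' c'
      by (intro exI[of _ b'] exI[of _ "\<lambda>v. - c' v"]) (auto simp: koszul_bd_uminus)
  qed
  then obtain b' c' where bc: "b' \<in> koszul_chains ?m (Suc p)" "c' \<in> koszul_chains ?m p"
    "\<And>v. koszul_bd fs b' v + f * c' v = b v" "\<And>v. - koszul_bd fs c' v = c v"
    by auto
  define a' where "a' = (\<lambda>w. case w of [] \<Rightarrow> 0 | x # v \<Rightarrow> if x then c' v else b' v)"
  have "a' \<in> koszul_chains (Suc ?m) (Suc p)"
    using bc(1,2) by (auto simp: a'_def koszul_chains_def split: list.split if_splits)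
  moreover have "koszul_bd (f # fs) a' w = a w" for w
  proof (cases w)
    case Nil
    then show ?thesis by (simp add: a_eq)
  next
    case (Cons x v)
    then show ?thesis using bc(3,4) by (cases x) (auto simp: a_eq a'_def)
  qed
  ultimately show ?case by auto
qed

section \<open>The lift of multiplication by \<open>g\<close> between two Koszul complexes\<close>

definition twisted_basis :: "'a::comm_ring_1 \<Rightarrow> bool list \<Rightarrow> bool list \<Rightarrow> 'a" where
  "twisted_basis g w v = (if w = v then if hd w then 1 else g else 0)"

text \<open>Both sides are the coefficient of the basis vector \<open>v\<close> in the boundary of
  the basis vector \<open>w\<close>; this certifies that the two recursions are transposes of each
  other.\<close>

lemma koszul_bd_basis:
  assumes "length w = length fs" "length v = length fs"
  shows "koszul_bd fs (\<lambda>v. if w = v then 1 else 0) v = koszul_comb fs (\<lambda>w. if w = v then 1 else 0) w"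
  using assms
proof (induction fs arbitrary: w v)
  case (Cons f fs)
  then obtain b w' c v' where w: "w = b # w'" "v = c # v'" "length w' = length fs" "length v' = length fs"
    by (metis length_Suc_conv)
  show ?case using Cons.IH[of w' v'] w by (cases b; cases c) auto
qed simp

text \<open>
  The vectors \<open>twisted_basis g w\<close> are the images of the basis vectors under the chain map from the
  Koszul complex on \<open>f, fs\<close> to the one on \<open>g f, fs\<close> lifting multiplication by \<open>g\<close>.
\<close>

lemma koszul_bd_twisted_basis:
  assumes "length w = Suc (length fs)" "length v = Suc (length fs)"
  shows "koszul_bd (g * f # fs) (twisted_basis g w) v =
    koszul_comb (f # fs) (\<lambda>w. twisted_basis g w v) w"
proof -
  obtain b w' c v' where w: "w = b # w'" "v = c # v'" "length w' = length fs" "length v' = length fs"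
    using assms by (metis length_Suc_conv)
  have 1: "(\<lambda>v. if w' = v then g else 0) = (\<lambda>v. g * (if w' = v then 1 else 0))"
    and 2: "(\<lambda>w. if w = v' then g else 0) = (\<lambda>w. g * (if w = v' then 1 else 0))"
    by auto
  show ?thesis
    using koszul_bd_basis[of w' fs v'] w
    by (cases b; cases c)
      (simp_all add: twisted_basis_def 1 2 koszul_bd_scale koszul_comb_scale cong: if_cong)
qed

section \<open>Homogeneous polynomials and ideals\<close>

lemma mdeg_add: "mdeg (m + m') = mdeg m + mdeg m'"
  by (simp add: mdeg_def lookup_add sum.distrib)

lemma mdeg_zero [simp]: "mdeg 0 = 0"
  by (simp add: mdeg_def)

lemma mdeg_eq_0_iff: "mdeg m = 0 \<longleftrightarrow> m = 0"
  by (auto simp: mdeg_def intro!: poly_mapping_eqI)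

lemma graded_partI: "(\<And>m. Poly_Mapping.lookup p m \<noteq> 0 \<Longrightarrow> int (mdeg m) = d) \<Longrightarrow> p \<in> graded_part d"
  by (auto simp: graded_part_def in_keys_iff)

lemma graded_partD: "p \<in> graded_part d \<Longrightarrow> Poly_Mapping.lookup p m \<noteq> 0 \<Longrightarrow> int (mdeg m) = d"
  by (auto simp: graded_part_def in_keys_iff)

lemma graded_part_zero [simp]: "0 \<in> graded_part d"
  by (simp add: graded_part_def)

lemma graded_part_add: "p \<in> graded_part d \<Longrightarrow> q \<in> graded_part d \<Longrightarrow> p + q \<in> graded_part d"
  by (rule graded_partI) (metis graded_partD lookup_add add_0)

lemma graded_part_uminus: "p \<in> graded_part d \<Longrightarrow> - p \<in> graded_part d"
  by (simp add: graded_part_def)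

lemma graded_part_diff: "p \<in> graded_part d \<Longrightarrow> q \<in> graded_part d \<Longrightarrow> p - q \<in> graded_part d"
  using graded_part_add[of p d "- q"] graded_part_uminus[of q d] by simp

lemma graded_part_mult:
  assumes "p \<in> graded_part a" "q \<in> graded_part b"
  shows "p * q \<in> graded_part (a + b)"
  unfolding graded_part_def
proof safe
  fix m assume "m \<in> Poly_Mapping.keys (p * q)"
  then obtain k l where "m = k + l" "k \<in> Poly_Mapping.keys p" "l \<in> Poly_Mapping.keys q"
    using keys_mult[of p q] by auto
  then show "int (mdeg m) = a + b"
    using assms by (auto simp: graded_part_def mdeg_add)
qed

lemma graded_part_one: "1 \<in> graded_part 0"
  by (rule graded_partI) (auto simp: lookup_one when_def split: if_splits)

lemma graded_part_power: "p \<in> graded_part a \<Longrightarrow> p ^ n \<in> graded_part (int n * a)"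
proof (induction n)
  case (Suc n)
  then have "p * p ^ n \<in> graded_part (a + int n * a)" by (intro graded_part_mult)
  then show ?case by (simp add: algebra_simps)
qed (simp add: graded_part_one)

lemma graded_part_neg: "p \<in> graded_part d \<Longrightarrow> d < 0 \<Longrightarrow> p = 0"
  by (metis graded_partD lookup_zero of_nat_less_0_iff poly_mapping_eqI)

definition hcomp :: "int \<Rightarrow> ('x::finite, 'k::comm_ring_1) mpoly \<Rightarrow> ('x, 'k) mpoly" where
  "hcomp d p = Abs_poly_mapping (\<lambda>m. if int (mdeg m) = d then Poly_Mapping.lookup p m else 0)"

lemma lookup_hcomp: "Poly_Mapping.lookup (hcomp d p) m = (if int (mdeg m) = d then Poly_Mapping.lookup p m else 0)"
proof -
  have "finite {m. (if int (mdeg m) = d then Poly_Mapping.lookup p m else 0) \<noteq> 0}"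
    by (rule finite_subset[OF _ finite_keys[of p]]) (auto simp: in_keys_iff split: if_splits)
  then show ?thesis unfolding hcomp_def by (subst lookup_Abs_poly_mapping) simp_all
qed

lemma hcomp_graded: "hcomp d p \<in> graded_part d"
  by (rule graded_partI) (auto simp: lookup_hcomp split: if_splits)

lemma hcomp_add: "hcomp d (p + q) = hcomp d p + hcomp d q"
  by (rule poly_mapping_eqI) (simp add: lookup_hcomp lookup_add)

lemma hcomp_diff: "hcomp d (p - q) = hcomp d p - hcomp d q"
  by (rule poly_mapping_eqI) (simp add: lookup_hcomp lookup_minus)

lemma hcomp_zero [simp]: "hcomp d 0 = 0"
  by (rule poly_mapping_eqI) (simp add: lookup_hcomp)

lemma hcomp_sum: "hcomp d (sum f A) = (\<Sum>i\<in>A. hcomp d (f i))"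
  by (induction A rule: infinite_finite_induct) (auto simp: hcomp_add)

lemma hcomp_of_graded: "p \<in> graded_part e \<Longrightarrow> hcomp d p = (if d = e then p else 0)"
  by (rule poly_mapping_eqI) (auto simp: lookup_hcomp dest: graded_partD)

lemma sum_hcomp: "(\<Sum>d\<in>(\<lambda>m. int (mdeg m)) ` Poly_Mapping.keys p. hcomp d p) = p"
proof (rule poly_mapping_eqI)
  fix m
  have "(\<Sum>d\<in>(\<lambda>m. int (mdeg m)) ` Poly_Mapping.keys p. if int (mdeg m) = d then Poly_Mapping.lookup p m else 0) = Poly_Mapping.lookup p m"
    by (auto simp: sum.delta' in_keys_iff)
  then show "Poly_Mapping.lookup (\<Sum>d\<in>(\<lambda>m. int (mdeg m)) ` Poly_Mapping.keys p. hcomp d p) m = Poly_Mapping.lookup p m"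
    by (simp add: lookup_sum lookup_hcomp)
qed

lemma hcomp_mult:
  assumes "f \<in> graded_part a"
  shows "hcomp d (f * g) = f * hcomp (d - a) g"
proof -
  let ?E = "(\<lambda>m. int (mdeg m)) ` Poly_Mapping.keys g"
  have "hcomp d (f * g) = hcomp d (\<Sum>e\<in>?E. f * hcomp e g)"
    by (simp add: sum_distrib_left[symmetric] sum_hcomp)
  also have "\<dots> = (\<Sum>e\<in>?E. if e = d - a then f * hcomp e g else 0)"
    unfolding hcomp_sum
  proof (rule sum.cong)
    fix e
    have "f * hcomp e g \<in> graded_part (a + e)" by (intro graded_part_mult assms hcomp_graded)
    then show "hcomp d (f * hcomp e g) = (if e = d - a then f * hcomp e g else 0)"
      by (auto simp: hcomp_of_graded)
  qed simp
  also have "\<dots> = (if d - a \<in> ?E then f * hcomp (d - a) g else 0)"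
    by (subst sum.delta) auto
  also have "\<dots> = f * hcomp (d - a) g"
  proof (cases "d - a \<in> ?E")
    case False
    then have "hcomp (d - a) g = 0"
      by (intro poly_mapping_eqI) (force simp: lookup_hcomp in_keys_iff)
    then show ?thesis by simp
  qed simp
  finally show ?thesis .
qed

definition homog_set :: "('x::finite, 'k::comm_ring_1) mpoly set \<Rightarrow> bool" where
  "homog_set A \<longleftrightarrow> (\<forall>f\<in>A. \<exists>a. f \<in> graded_part a)"

lemma homog_set_empty [simp]: "homog_set {}"
  and homog_set_insert: "f \<in> graded_part a \<Longrightarrow> homog_set A \<Longrightarrow> homog_set (insert f A)"
  and homog_set_Un: "homog_set A \<Longrightarrow> homog_set B \<Longrightarrow> homog_set (A \<union> B)"
  by (auto simp: homog_set_def)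

lemma homog_set_prod_gens: "homog_set A \<Longrightarrow> homog_set (prod_gens A s)"
proof (induction s)
  case (Suc s)
  then show ?case by (auto simp: homog_set_def) (metis graded_part_mult)
qed (auto simp: homog_set_def intro: graded_part_one)

lemma hcomp_ideal_gen:
  assumes "homog_set A" "g \<in> ideal_gen A"
  shows "hcomp d g \<in> ideal_gen A"
  using assms(2)
proof (induction arbitrary: d rule: ideal.span_induct_alt)
  case (step c x y)
  obtain a where a: "x \<in> graded_part a" using assms(1) step(1) by (auto simp: homog_set_def)
  have "hcomp d (c * x + y) = x * hcomp (d - a) c + hcomp d y"
    by (simp add: hcomp_add hcomp_mult[OF a] mult.commute[of c])
  also have "\<dots> \<in> ideal_gen A"
    by (intro ideal.span_add step ideal_gen_mult_right) (rule ideal.span_base[OF step(1)])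
  finally show ?case .
qed (simp add: ideal.span_zero)

lemma hcomp_ideal_genI:
  assumes "\<And>d. hcomp d g \<in> ideal_gen A"
  shows "g \<in> ideal_gen A"
  by (subst sum_hcomp[symmetric]) (intro ideal.span_sum assms)

section \<open>Permutability of homogeneous regular sequences\<close>

text \<open>A graded Nakayama argument by descent on degree. If \<open>g * x\<close> lies in the
  ideal, then \<open>x = f * h\<close> modulo \<open>A\<close> with \<open>h\<close> homogeneous of
  degree smaller by \<open>a > 0\<close>, and after cancelling \<open>f\<close> the product
  \<open>g * h\<close> lies in the ideal again. Negative degrees contain only 0.\<close>

lemma nzd_homog_descend:
  assumes A: "homog_set A" and f: "f \<in> graded_part a" "a > 0" "nzd A f"
    and g: "g \<in> graded_part b" "nzd (insert f A) g"
  shows "nzd A g"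
proof -
  have main: "x \<in> ideal_gen A"
    if "x \<in> graded_part d" "d < int n" "g * x \<in> ideal_gen A" for x d n
    using that
  proof (induction n arbitrary: x d)
    case 0
    then show ?case using graded_part_neg[of x d] by (simp add: ideal.span_zero)
  next
    case (Suc n)
    have "g * x \<in> ideal_gen (insert f A)"
      using Suc.prems(3) ideal.span_mono[of A "insert f A"] by auto
    then obtain h where "x - f * h \<in> ideal_gen A"
      using nzdD[OF g(2)] by (auto simp: ideal_gen_insert_iff)
    then have "hcomp d (x - f * h) \<in> ideal_gen A" by (rule hcomp_ideal_gen[OF A])
    then have *: "x - f * hcomp (d - a) h \<in> ideal_gen A"
      using Suc.prems(1) by (simp add: hcomp_diff hcomp_mult[OF f(1)] hcomp_of_graded)
    have "g * x - g * (x - f * hcomp (d - a) h) \<in> ideal_gen A"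
      by (intro ideal.span_diff Suc.prems ideal_gen_mult *)
    then have "f * (g * hcomp (d - a) h) \<in> ideal_gen A" by (simp add: algebra_simps)
    then have "g * hcomp (d - a) h \<in> ideal_gen A" by (rule nzdD[OF f(3)])
    then have "hcomp (d - a) h \<in> ideal_gen A"
      using Suc.IH[OF hcomp_graded] Suc.prems(2) f(2) by auto
    then have "(x - f * hcomp (d - a) h) + f * hcomp (d - a) h \<in> ideal_gen A"
      by (intro ideal.span_add * ideal_gen_mult)
    then show ?case by simp
  qed
  show ?thesis unfolding nzd_def
  proof safe
    fix x assume "g * x \<in> ideal_gen A"
    then have "hcomp (d + b) (g * x) \<in> ideal_gen A" for d by (rule hcomp_ideal_gen[OF A])
    then have "g * hcomp d x \<in> ideal_gen A" for d by (simp add: hcomp_mult[OF g(1)])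
    then have "hcomp d x \<in> ideal_gen A" for d
      using main[OF hcomp_graded, of d "nat d + 1" x] by simp
    then show "x \<in> ideal_gen A" by (rule hcomp_ideal_genI)
  qed
qed

definition pos_homog :: "('x::finite, 'k::comm_ring_1) mpoly \<Rightarrow> bool" where
  "pos_homog f \<longleftrightarrow> (\<exists>a>0. f \<in> graded_part a)"

lemma reg_seq_move:
  assumes "homog_set A" "reg_seq A (f # xs @ ys)" "pos_homog f" "\<forall>x\<in>set xs. pos_homog x"
  shows "reg_seq A (xs @ f # ys)"
  using assms
proof (induction xs arbitrary: A)
  case (Cons x xs)
  then obtain a b where ab: "a > 0" "f \<in> graded_part a" "x \<in> graded_part b"
    by (auto simp: pos_homog_def)
  have f: "nzd A f" and x: "nzd (insert f A) x" and r: "reg_seq (insert x (insert f A)) (xs @ ys)"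
    using Cons.prems by simp_all
  have "nzd A x" by (rule nzd_homog_descend[OF Cons.prems(1) ab(2,1) f ab(3) x])
  moreover have "reg_seq (insert x A) (f # xs @ ys)"
    using nzd_insert_swap[OF f x] r by (simp add: insert_commute)
  then have "reg_seq (insert x A) (xs @ f # ys)"
    using Cons.IH[of "insert x A"] homog_set_insert[OF ab(3) Cons.prems(1)] Cons.prems by simp
  ultimately show ?case by simp
qed simp

text \<open>The tail is permuted modulo \<open>f\<close> by induction; \<open>reg_seq_move\<close>
  then carries \<open>f\<close> to its place.\<close>

lemma homog_reg_seq_perm:
  "homog_set A \<Longrightarrow> reg_seq A fs \<Longrightarrow> \<forall>f\<in>set fs. pos_homog f \<Longrightarrow> perm_reg_seq A fs"
proof (induction fs arbitrary: A)
  case Nil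
  then show ?case by (simp add: perm_reg_seq_def)
next
  case (Cons f fs)
  obtain a where a: "f \<in> graded_part a" using Cons.prems by (auto simp: pos_homog_def)
  have IH: "perm_reg_seq (insert f A) fs"
    using Cons.IH[of "insert f A"] homog_set_insert[OF a Cons.prems(1)] Cons.prems by simp
  show ?case unfolding perm_reg_seq_def
  proof safe
    fix gs assume gs: "mset gs = mset (f # fs)"
    then have "f \<in> set gs" by (metis list.set_intros(1) set_mset_mset)
    then obtain xs ys where xy: "gs = xs @ f # ys" by (meson split_list)
    have m: "mset (xs @ ys) = mset fs" using gs xy by simp
    then have "reg_seq A (f # xs @ ys)"
      using perm_reg_seq_imp[OF IH m] Cons.prems by simp
    moreover have "set (xs @ ys) = set fs" using m by (metis set_mset_mset)
    ultimately show "reg_seq A gs"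
      unfolding xy using Cons.prems by (intro reg_seq_move) auto
  qed
qed

section \<open>Constant coefficients\<close>

lemma lookup_single_mult: "Poly_Mapping.lookup (Poly_Mapping.single 0 c * p) m = c * Poly_Mapping.lookup p m"
  unfolding mult_map_scale_conv_mult[symmetric] by (simp add: map.rep_eq when_def)

text \<open>Taking constant coefficients plays the part of reduction modulo the irrelevant ideal. It
  is multiplicative because an exponent sum is 0 only if both exponents are.\<close>

lemma lookup_mult_zero:
  fixes p q :: "('x::finite, 'k::comm_ring_1) mpoly"
  shows "Poly_Mapping.lookup (p * q) 0 = Poly_Mapping.lookup p 0 * Poly_Mapping.lookup q 0"
proof -
  define p' where "p' = p - Poly_Mapping.single 0 (Poly_Mapping.lookup p 0)"
  have p': "Poly_Mapping.lookup p' 0 = 0" by (simp add: p'_def lookup_minus)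
  have "0 \<notin> Poly_Mapping.keys (p' * q)"
  proof
    assume "0 \<in> Poly_Mapping.keys (p' * q)"
    then obtain k l where kl: "0 = k + l" "k \<in> Poly_Mapping.keys p'"
      using keys_mult[of p' q] by auto
    then have "mdeg k + mdeg l = 0" by (metis mdeg_add mdeg_zero)
    then have "k = 0" by (simp add: mdeg_eq_0_iff)
    then show False using kl p' by (simp add: in_keys_iff)
  qed
  then have "Poly_Mapping.lookup (p' * q) 0 = 0" by (simp add: in_keys_iff)
  moreover have "p = Poly_Mapping.single 0 (Poly_Mapping.lookup p 0) + p'" by (simp add: p'_def)
  then have "p * q = Poly_Mapping.single 0 (Poly_Mapping.lookup p 0) * q + p' * q" by (metis distrib_right)
  ultimately show ?thesis by (simp add: lookup_add lookup_single_mult)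
qed

lemma ideal_gen_lookup_zero:
  fixes A :: "('x::finite, 'k::comm_ring_1) mpoly set"
  assumes "\<And>f. f \<in> A \<Longrightarrow> Poly_Mapping.lookup f 0 = 0" "p \<in> ideal_gen A"
  shows "Poly_Mapping.lookup p 0 = 0"
  using assms(2)
  by (induction rule: ideal.span_induct_alt) (auto simp: lookup_add lookup_mult_zero assms(1))

lemma irrelevant_ideal_lookup_zero:
  fixes p :: "('x::finite, 'k::comm_ring_1) mpoly"
  assumes "p \<in> irrelevant_ideal"
  shows "Poly_Mapping.lookup p 0 = 0"
proof (rule ideal_gen_lookup_zero)
  show "p \<in> ideal_gen (range Var)" using assms by (simp add: irrelevant_ideal_def)
  show "Poly_Mapping.lookup f 0 = 0" if "f \<in> range Var" for f :: "('x, 'k) mpoly"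
    using that by (auto simp: Var_def lookup_single when_def poly_mapping_eq_iff fun_eq_iff split: if_splits)
qed

lemma graded_part_lookup_zero: "p \<in> graded_part d \<Longrightarrow> d \<noteq> 0 \<Longrightarrow> Poly_Mapping.lookup p 0 = 0"
  by (metis graded_partD mdeg_zero of_nat_0)

lemma graded_part_pos:
  assumes "p \<in> graded_part d" "Poly_Mapping.lookup p 0 = 0" "p \<noteq> 0"
  shows "d > 0"
proof -
  obtain m where m: "Poly_Mapping.lookup p m \<noteq> 0" using assms(3) by (metis lookup_zero poly_mapping_eqI)
  then have "int (mdeg m) = d" "m \<noteq> 0" using assms graded_partD by auto
  then show ?thesis using mdeg_eq_0_iff[of m] by linarith
qed

section \<open>Hilbert functions of homogeneous ideals\<close>

lemma (in vector_space) finite_basis_exists: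
  assumes "V \<subseteq> span W" "finite W"
  obtains B where "B \<subseteq> V" "independent B" "V \<subseteq> span B" "card B = dim V" "finite B"
proof -
  obtain B where B: "B \<subseteq> V" "independent B" "V \<subseteq> span B" "card B = dim V"
    by (rule basis_exists)
  moreover have "finite B" using independent_span_bound[OF assms(2) B(2)] B(1) assms(1) by auto
  ultimately show ?thesis by (rule that)
qed

lemma (in vector_space) dim_mono_finite:
  assumes "U \<subseteq> V" "V \<subseteq> span W" "finite W"
  shows "dim U \<le> dim V"
proof -
  obtain B where "B \<subseteq> V" "independent B" "V \<subseteq> span B" "card B = dim V" "finite B"
    by (rule finite_basis_exists[OF assms(2,3)])
  then show ?thesis using dim_le_card[of U B] assms(1) by auto
qed

text \<open>Rank-nullity for the map from \<open>V\<close> to \<open>(W + g V) / W\<close>. A basis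
  of its kernel is extended to one of \<open>V\<close>, and the images of the added vectors are
  joined to a basis of \<open>W\<close>.\<close>

lemma (in vector_space) dim_sum_image_plus_dim_preimage:
  assumes g: "Vector_Spaces.linear scale scale g"
    and V: "subspace V" "V \<subseteq> span BV" "finite BV"
    and W: "subspace W" "W \<subseteq> span BW" "finite BW"
  shows "dim {y + g x | x y. x \<in> V \<and> y \<in> W} + dim {x\<in>V. g x \<in> W} = dim V + dim W"
proof -
  interpret g: Vector_Spaces.linear scale scale g by (rule g)
  let ?K = "{x\<in>V. g x \<in> W}"
  obtain BK where BK: "BK \<subseteq> ?K" "independent BK" "?K \<subseteq> span BK" "card BK = dim ?K" "finite BK"
    by (rule finite_basis_exists[of ?K BV]) (use V in auto)
  have "BK \<subseteq> V" using BK(1) by auto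
  from maximal_independent_subset_extend[OF this BK(2)]
  obtain B where B: "BK \<subseteq> B" "B \<subseteq> V" "independent B" "V \<subseteq> span B" by metis
  have finB: "finite B" using independent_span_bound[OF V(3) B(3)] B(2) V(2) by auto
  obtain C where C: "C \<subseteq> W" "independent C" "W \<subseteq> span C" "card C = dim W" "finite C"
    by (rule finite_basis_exists[OF W(2,3)])
  have span_C: "span C \<subseteq> W" using span_minimal[OF C(1) W(1)] .
  \<comment> \<open>A relation expressing \<open>g b\<close> by the rest would put
    \<open>b - x\<close> into the kernel, hence \<open>b\<close> into the span of the other basis
    vectors. The cardinality is carried along to know that \<open>g\<close> merges no two of
    them.\<close>
  have "independent (C \<union> g ` X) \<and> card (C \<union> g ` X) = card C + card X" if "X \<subseteq> B - BK" for X
    using finite_subset[OF that finite_Diff[OF finB]] that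
  proof (induction X rule: finite_induct)
    case empty
    then show ?case using C by simp
  next
    case (insert b X)
    have "g b \<notin> span (C \<union> g ` X)"
    proof
      assume "g b \<in> span (C \<union> g ` X)"
      then obtain y x where xy: "g b = y + g x" "y \<in> span C" "x \<in> span X"
        unfolding span_Un g.span_image by auto
      have "x \<in> V" using xy(3) span_minimal[OF _ V(1), of X] insert.prems B(2) by auto
      then have "b - x \<in> ?K"
        using xy insert.prems B(2) span_C V(1) by (auto simp: g.diff intro: subspace_diff)
      then have "(b - x) + x \<in> span (BK \<union> X)"
        using BK(3) xy(3) span_mono[of BK "BK \<union> X"] span_mono[of X "BK \<union> X"]
        by (intro span_add) auto
      then have "b \<in> span (B - {b})"
        using span_mono[of "BK \<union> X" "B - {b}"] insert B(1) by auto
      then show False using B(3) insert.prems by (auto simp: dependent_def)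
    qed
    moreover have "g b \<notin> C \<union> g ` X" using calculation by (meson span_base)
    ultimately show ?case
      using insert C(5) independent_insertI[of "g b" "C \<union> g ` X"] by auto
  qed
  from this[of "B - BK"] have ind: "independent (C \<union> g ` (B - BK))"
    and card: "card (C \<union> g ` (B - BK)) = card C + card (B - BK)" by auto
  let ?S = "{y + g x | x y. x \<in> V \<and> y \<in> W}"
  have "dim ?S = card (C \<union> g ` (B - BK))"
  proof (rule dim_unique[OF _ _ ind refl])
    have "c \<in> ?S" if "c \<in> C" for c
      using that C(1) subspace_0[OF V(1)] by (intro CollectI exI[of _ 0] exI[of _ c]) (auto simp: g.zero)
    moreover have "g x \<in> ?S" if "x \<in> B" for x
      using that B(2) subspace_0[OF W(1)] by (intro CollectI exI[of _ x] exI[of _ 0]) auto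
    ultimately show "C \<union> g ` (B - BK) \<subseteq> ?S" by auto
    show "?S \<subseteq> span (C \<union> g ` (B - BK))"
    proof safe
      fix x y assume xy: "x \<in> V" "y \<in> W"
      have "x \<in> span (BK \<union> (B - BK))" using B(1,4) xy by (auto simp: Un_absorb1)
      then obtain k z where kz: "x = k + z" "k \<in> span BK" "z \<in> span (B - BK)"
        unfolding span_Un by auto
      have "subspace ?K"
        using V(1) W(1) by (auto simp: subspace_def g.add g.scale g.zero)
      then have "g k \<in> W" using kz(2) span_minimal[OF BK(1)] by auto
      then have "y + g k \<in> span C" using xy C(3) W(1) subspace_add by blast
      moreover have "g z \<in> span (g ` (B - BK))" using kz by (auto simp: g.span_image)
      ultimately have "(y + g k) + g z \<in> span (C \<union> g ` (B - BK))"
        unfolding span_Un by blast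
      then show "y + g x \<in> span (C \<union> g ` (B - BK))" by (simp add: kz(1) g.add add.assoc)
    qed
  qed
  moreover have "dim V = card B" by (rule dim_unique[OF B(2,4,3) refl])
  moreover have "card (B - BK) = card B - card BK" "card BK \<le> card B"
    using B(1) finB BK(5) by (auto simp: card_Diff_subset card_mono)
  ultimately show ?thesis using card C(4) BK(4) by simp
qed

section \<open>Monomial bases and Hilbert functions\<close>

interpretation mpoly_vs: vector_space "mpoly_scale :: 'k::field \<Rightarrow> ('x, 'k) mpoly \<Rightarrow> ('x, 'k) mpoly"
  by (rule vector_space_mpoly_scale)

lemma lookup_mpoly_scale: "Poly_Mapping.lookup (mpoly_scale c p) m = c * Poly_Mapping.lookup p m"
  by (simp add: mpoly_scale_def lookup_single_mult)

definition exponents :: "nat \<Rightarrow> ('x::finite \<Rightarrow>\<^sub>0 nat) set" where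
  "exponents d = {m. mdeg m = d}"

text \<open>Enumerating the variables reduces the count of monomials to the stars-and-bars formula
  for lists with given length and sum.\<close>

lemma bij_betw_exponents:
  "\<exists>f. bij_betw f (exponents d :: ('x::finite \<Rightarrow>\<^sub>0 nat) set) {l. length l = CARD('x) \<and> sum_list l = d}"
proof -
  let ?n = "CARD('x)"
  obtain h :: "nat \<Rightarrow> 'x" where h: "bij_betw h {0..<?n} UNIV"
    using ex_bij_betw_nat_finite[of "UNIV :: 'x set"] by auto
  let ?f = "\<lambda>m. map (\<lambda>i. Poly_Mapping.lookup m (h i)) [0..<?n]"
  let ?g = "\<lambda>l. Abs_poly_mapping (\<lambda>x. l ! inv_into {0..<?n} h x)"
  have lookup_g: "Poly_Mapping.lookup (?g l) x = l ! inv_into {0..<?n} h x" for l :: "nat list" and x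
    by (subst lookup_Abs_poly_mapping) simp_all
  have sum: "sum_list (?f m) = mdeg m" for m
    unfolding mdeg_def sum_list_sum_nth
    using sum.reindex_bij_betw[OF h, of "Poly_Mapping.lookup m"] by simp
  have fg: "?f (?g l) = l" if "length l = ?n" for l
    using that bij_betw_inv_into_left[OF h] by (intro nth_equalityI) (auto simp: lookup_g)
  have "bij_betw ?f (exponents d) {l. length l = ?n \<and> sum_list l = d}"
  proof (rule bij_betw_byWitness[where f' = ?g])
    have "?g (?f m) = m" for m
    proof (rule poly_mapping_eqI)
      fix x
      have "inv_into {0..<?n} h x < ?n" "h (inv_into {0..<?n} h x) = x"
        using h inv_into_into[of x h "{0..<?n}"] f_inv_into_f[of x h "{0..<?n}"]
        by (auto simp: bij_betw_def)
      then show "Poly_Mapping.lookup (?g (?f m)) x = Poly_Mapping.lookup m x"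
        by (simp add: lookup_g)
    qed
    then show "\<forall>m\<in>exponents d. ?g (?f m) = m" by blast
    show "\<forall>l\<in>{l. length l = ?n \<and> sum_list l = d}. ?f (?g l) = l" using fg by blast
    show "?f ` exponents d \<subseteq> {l. length l = ?n \<and> sum_list l = d}"
      using sum by (auto simp: exponents_def)
    show "?g ` {l. length l = ?n \<and> sum_list l = d} \<subseteq> exponents d"
    proof safe
      fix l :: "nat list" assume "length l = ?n" "d = sum_list l"
      then show "?g l \<in> exponents (sum_list l)" using sum[of "?g l"] fg[of l] by (simp add: exponents_def)
    qed
  qed
  then show ?thesis by blast
qed

lemma card_exponents: "card (exponents d :: ('x::finite \<Rightarrow>\<^sub>0 nat) set) = (d + CARD('x) - 1) choose d"
proof -
  obtain f where f: "bij_betw f (exponents d :: ('x \<Rightarrow>\<^sub>0 nat) set) {l. length l = CARD('x) \<and> sum_list l = d}"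
    using bij_betw_exponents by blast
  show ?thesis using bij_betw_same_card[OF f] by (simp add: card_length_sum_list)
qed

lemma finite_exponents: "finite (exponents d :: ('x::finite \<Rightarrow>\<^sub>0 nat) set)"
proof -
  obtain f where "bij_betw f (exponents d :: ('x \<Rightarrow>\<^sub>0 nat) set) {l. length l = CARD('x) \<and> sum_list l = d}"
    using bij_betw_exponents by blast
  moreover have "{l. length l = CARD('x) \<and> sum_list l = d} \<subseteq> {l. set l \<subseteq> {..d} \<and> length l = CARD('x)}"
    using member_le_sum_list by fastforce
  then have "finite {l. length l = CARD('x) \<and> sum_list l = d}"
    by (rule finite_subset) (simp add: finite_lists_length_eq)
  ultimately show ?thesis using bij_betw_finite by blast
qed

definition monomials :: "nat \<Rightarrow> ('x::finite, 'k::field) mpoly set" where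
  "monomials d = (\<lambda>m. Poly_Mapping.single m 1) ` exponents d"

lemma inj_monomial: "inj_on (\<lambda>m. Poly_Mapping.single m (1::'k::field)) A"
  by (rule inj_onI) (metis lookup_single_eq lookup_single_not_eq zero_neq_one)

lemma finite_monomials: "finite (monomials d)"
  by (simp add: monomials_def finite_exponents)

lemma sum_monomials:
  "(\<Sum>v\<in>monomials d. mpoly_scale (u v) v) =
    (\<Sum>m\<in>exponents d. mpoly_scale (u (Poly_Mapping.single m 1)) (Poly_Mapping.single m 1))"
  unfolding monomials_def by (subst sum.reindex[OF inj_monomial]) simp

lemma lookup_sum_monomials:
  "Poly_Mapping.lookup (\<Sum>m\<in>exponents d. mpoly_scale (c m) (Poly_Mapping.single m 1)) m' =
    (if m' \<in> exponents d then c m' else 0)"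
proof -
  have "Poly_Mapping.lookup (\<Sum>m\<in>exponents d. mpoly_scale (c m) (Poly_Mapping.single m 1)) m' =
    (\<Sum>m\<in>exponents d. if m = m' then c m else 0)"
    unfolding lookup_sum by (intro sum.cong) (auto simp: lookup_mpoly_scale lookup_single when_def)
  then show ?thesis by (simp add: sum.delta finite_exponents)
qed

lemma independent_monomials: "mpoly_vs.independent (monomials d :: ('x::finite, 'k::field) mpoly set)"
proof (subst mpoly_vs.dependent_finite[OF finite_monomials], safe)
  fix u :: "('x, 'k) mpoly \<Rightarrow> 'k" and v :: "('x, 'k) mpoly"
  assume "(\<Sum>v\<in>monomials d. mpoly_scale (u v) v) = 0" "v \<in> monomials d" "u v \<noteq> 0"
  then obtain m where m: "v = Poly_Mapping.single m 1" "m \<in> exponents d" by (auto simp: monomials_def)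
  have "Poly_Mapping.lookup (\<Sum>v\<in>monomials d. mpoly_scale (u v) v) m = u v"
    unfolding sum_monomials lookup_sum_monomials using m by simp
  then show False
    using \<open>(\<Sum>v\<in>monomials d. mpoly_scale (u v) v) = 0\<close> \<open>u v \<noteq> 0\<close> by simp
qed

lemma monomials_subset: "monomials d \<subseteq> graded_part (int d)"
  by (auto simp: monomials_def exponents_def lookup_single when_def intro!: graded_partI split: if_splits)

lemma graded_part_subset_span: "(graded_part (int d) :: ('x::finite, 'k::field) mpoly set) \<subseteq> mpoly_vs.span (monomials d)"
proof
  fix p :: "('x, 'k) mpoly" assume p: "p \<in> graded_part (int d)"
  let ?s = "\<Sum>m\<in>exponents d. mpoly_scale (Poly_Mapping.lookup p m) (Poly_Mapping.single m 1)"
  have "p = ?s"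
  proof (rule poly_mapping_eqI)
    fix m show "Poly_Mapping.lookup p m = Poly_Mapping.lookup ?s m"
      unfolding lookup_sum_monomials using graded_partD[OF p, of m] by (auto simp: exponents_def)
  qed
  also have "?s \<in> mpoly_vs.span (monomials d)"
    by (intro mpoly_vs.span_sum mpoly_vs.span_scale mpoly_vs.span_base) (auto simp: monomials_def)
  finally show "p \<in> mpoly_vs.span (monomials d)" .
qed

lemma dim_graded_part:
  "mpoly_vs.dim (graded_part (int d) :: ('x::finite, 'k::field) mpoly set) = (d + CARD('x) - 1) choose d"
  using mpoly_vs.dim_unique[OF monomials_subset graded_part_subset_span independent_monomials refl]
  by (simp add: monomials_def card_image[OF inj_monomial] card_exponents)

lemma mpoly_scale_graded: "p \<in> graded_part d \<Longrightarrow> mpoly_scale c p \<in> graded_part d"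
  by (rule graded_partI) (metis graded_partD lookup_mpoly_scale mult_zero_right)

lemma subspace_graded_part: "mpoly_vs.subspace (graded_part d)"
  by (auto simp: mpoly_vs.subspace_def intro: graded_part_add mpoly_scale_graded)

lemma subspace_ideal_gen: "mpoly_vs.subspace (ideal_gen A)"
  by (auto simp: mpoly_vs.subspace_def mpoly_scale_def
      intro: ideal.span_add ideal.span_zero ideal_gen_mult)

lemma dim_inter_graded_part_le:
  "mpoly_vs.dim (J \<inter> graded_part (int d) :: ('x, 'k) mpoly set) \<le> mpoly_vs.dim (graded_part (int d) :: ('x::finite, 'k::field) mpoly set)"
  by (rule mpoly_vs.dim_mono_finite[OF _ graded_part_subset_span finite_monomials]) auto

lemma real_hilbert_function:
  "real (hilbert_function J d) = real (mpoly_vs.dim (graded_part (int d) :: ('x::finite, 'k::field) mpoly set))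
    - real (mpoly_vs.dim (J \<inter> graded_part (int d) :: ('x, 'k) mpoly set))"
  unfolding hilbert_function_def by (rule of_nat_diff[OF dim_inter_graded_part_le])

lemma hilbert_function_UNIV: "hilbert_function UNIV d = 0"
  by (simp add: hilbert_function_def)

lemma hilbert_function_zero:
  "hilbert_function ({0} :: ('x::finite, 'k::field) mpoly set) d = (d + CARD('x) - 1) choose d"
proof -
  have "mpoly_vs.dim ({0} :: ('x, 'k) mpoly set) = 0"
    using mpoly_vs.dim_le_card[of "{0}" "{}"] by simp
  moreover have "{0} \<inter> graded_part (int d) = ({0} :: ('x, 'k) mpoly set)" by auto
  ultimately show ?thesis by (simp add: hilbert_function_def dim_graded_part)
qed

text \<open>A nonzero constant in the ideal would be a unit, so the constants survive in the
  quotient.\<close>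

lemma hilbert_function_0_pos:
  fixes A :: "('x::finite, 'k::field) mpoly set"
  assumes A: "homog_set A" and proper: "ideal_gen A \<noteq> UNIV"
  shows "hilbert_function (ideal_gen A) 0 > 0"
proof -
  have "ideal_gen A \<inter> graded_part 0 \<subseteq> mpoly_vs.span {}"
  proof safe
    fix p :: "('x, 'k) mpoly" assume p: "p \<in> ideal_gen A" "p \<in> graded_part 0"
    define c where "c = Poly_Mapping.lookup p 0"
    have pc: "p = Poly_Mapping.single 0 c"
      using graded_partD[OF p(2)] mdeg_eq_0_iff
      by (intro poly_mapping_eqI) (auto simp: c_def lookup_single when_def)
    have "c = 0"
    proof (rule ccontr)
      assume "c \<noteq> 0"
      then have "Poly_Mapping.single 0 (inverse c) * p = 1" by (simp add: pc mult_single)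
      then have "1 \<in> ideal_gen A" using ideal_gen_mult[OF p(1)] by metis
      then show False using proper by (simp add: ideal_gen_eq_UNIV_iff)
    qed
    then show "p \<in> mpoly_vs.span {}" using pc by simp
  qed
  then have "mpoly_vs.dim (ideal_gen A \<inter> graded_part (int 0)) \<le> card ({} :: ('x, 'k) mpoly set)"
    by (intro mpoly_vs.dim_le_card) auto
  then show ?thesis unfolding hilbert_function_def dim_graded_part by simp
qed

text \<open>Additivity along the exact sequence \<open>0 \<rightarrow> R/(A : f)(-a) \<rightarrow> R/A \<rightarrow> R/(A + f) \<rightarrow> 0\<close>.\<close>

lemma hilbert_function_colon:
  fixes A K :: "('x::finite, 'k::field) mpoly set"
  assumes A: "homog_set A" and f: "f \<in> graded_part (int a)"
    and colon: "\<And>g. f * g \<in> ideal_gen A \<longleftrightarrow> g \<in> ideal_gen K"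
  shows "real (hilbert_function (ideal_gen A) d) = real (hilbert_function (ideal_gen (insert f A)) d) +
    (if a \<le> d then real (hilbert_function (ideal_gen K) (d - a)) else 0)"
proof -
  let ?A = "ideal_gen A" and ?Af = "ideal_gen (insert f A)"
  have sub: "?A \<subseteq> ?Af" by (rule ideal.span_mono) auto
  \<comment> \<open>Passing to components of degree \<open>d\<close> replaces the cofactor of
    \<open>f\<close> by a homogeneous one of degree \<open>d - a\<close>; it is 0 if this degree is
    negative.\<close>
  have split: "\<exists>h\<in>graded_part (int d - int a). x - f * h \<in> ?A \<inter> graded_part (int d)"
    if x: "x \<in> ?Af" "x \<in> graded_part (int d)" for x
  proof -
    obtain h where "x - f * h \<in> ?A" using x(1) unfolding ideal_gen_insert_iff by blast
    then have "hcomp (int d) (x - f * h) \<in> ?A" by (rule hcomp_ideal_gen[OF A])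
    moreover have "hcomp (int d) (x - f * h) = x - f * hcomp (int d - int a) h"
      using x(2) by (simp add: hcomp_diff hcomp_mult[OF f] hcomp_of_graded)
    ultimately show ?thesis
      using hcomp_graded[of "int d" "x - f * h"] hcomp_graded[of "int d - int a" h] by auto
  qed
  show ?thesis
  proof (cases "a \<le> d")
    case False
    have "?Af \<inter> graded_part (int d) = ?A \<inter> graded_part (int d)"
    proof
      show "?Af \<inter> graded_part (int d) \<subseteq> ?A \<inter> graded_part (int d)"
      proof safe
        fix x assume x: "x \<in> ?Af" "x \<in> graded_part (int d)"
        obtain h where "h \<in> graded_part (int d - int a)" "x - f * h \<in> ?A"
          using split[OF x] by auto
        moreover then have "h = 0" using graded_part_neg False by fastforce
        ultimately show "x \<in> ?A" by simp
      qed
    qed (use sub in auto)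
    then show ?thesis using False by (simp add: hilbert_function_def)
  next
    case True
    define V where "V = (graded_part (int (d - a)) :: ('x, 'k) mpoly set)"
    define W where "W = ?A \<inter> graded_part (int d)"
    have lin: "Vector_Spaces.linear mpoly_scale mpoly_scale ((*) f)"
      unfolding module_hom_iff_linear[symmetric] module_hom_iff
      using mpoly_vs.module_axioms by (simp add: distrib_left mpoly_scale_def mult.left_commute)
    have dims: "mpoly_vs.dim {y + f * x | x y. x \<in> V \<and> y \<in> W} + mpoly_vs.dim {x\<in>V. f * x \<in> W} =
      mpoly_vs.dim V + mpoly_vs.dim W"
    proof (rule mpoly_vs.dim_sum_image_plus_dim_preimage[OF lin])
      show "V \<subseteq> mpoly_vs.span (monomials (d - a))" unfolding V_def by (rule graded_part_subset_span)
      show "W \<subseteq> mpoly_vs.span (monomials d)" unfolding W_def using graded_part_subset_span by auto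
    qed (auto simp: V_def W_def finite_monomials intro!: subspace_graded_part mpoly_vs.subspace_inter subspace_ideal_gen)
    have f_graded: "f * x \<in> graded_part (int d)" if "x \<in> V" for x
      using graded_part_mult[OF f, of x "int (d - a)"] that True by (simp add: V_def of_nat_diff)
    then have preimage: "{x\<in>V. f * x \<in> W} = ideal_gen K \<inter> V"
      by (auto simp: W_def colon)
    have image: "{y + f * x | x y. x \<in> V \<and> y \<in> W} = ?Af \<inter> graded_part (int d)"
    proof safe
      fix x y assume xy: "x \<in> V" "y \<in> W"
      show "y + f * x \<in> ?Af"
      proof (rule ideal.span_add)
        show "y \<in> ?Af" using xy sub by (auto simp: W_def)
        show "f * x \<in> ?Af" by (intro ideal_gen_mult_right ideal.span_base) simp
      qed
      show "y + f * x \<in> graded_part (int d)"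
        using xy f_graded by (intro graded_part_add) (auto simp: W_def)
    next
      fix x assume x: "x \<in> ?Af" "x \<in> graded_part (int d)"
      obtain h where "h \<in> graded_part (int d - int a)" "x - f * h \<in> W"
        using split[OF x] by (auto simp: W_def)
      then have "h \<in> V" "x = (x - f * h) + f * h" using True by (auto simp: V_def of_nat_diff)
      then show "\<exists>h y. x = y + f * h \<and> h \<in> V \<and> y \<in> W" using \<open>x - f * h \<in> W\<close> by metis
    qed
    have "real (mpoly_vs.dim (?Af \<inter> graded_part (int d))) + real (mpoly_vs.dim (ideal_gen K \<inter> V)) =
      real (mpoly_vs.dim V) + real (mpoly_vs.dim W)"
      using dims unfolding image preimage of_nat_add[symmetric] by (rule arg_cong)
    then show ?thesis
      using True unfolding real_hilbert_function by (simp add: V_def W_def)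
  qed
qed

section \<open>Multiplicity of complete intersections and of their powers\<close>

text \<open>The effect on a Hilbert function of twisting the module by \<open>-a\<close>.\<close>

definition shift :: "nat \<Rightarrow> (nat \<Rightarrow> real) \<Rightarrow> nat \<Rightarrow> real" where
  "shift a H d = (if a \<le> d then H (d - a) else 0)"

text \<open>
  \<open>has_mult \<delta> e H\<close> says that \<open>H\<close> behaves like the Hilbert function of a graded module of dimension at
  most \<open>\<delta>\<close> whose multiplicity in dimension \<open>\<delta>\<close> is \<open>e\<close>; \<open>e = 0\<close> is allowed and makes the
  predicate additive.
\<close>

definition has_mult :: "nat \<Rightarrow> real \<Rightarrow> (nat \<Rightarrow> real) \<Rightarrow> bool" where
  "has_mult \<delta> e H \<longleftrightarrow> (case \<delta> of
     0 \<Rightarrow> \<forall>\<^sub>F N in sequentially. H N = 0 \<and> (\<Sum>d<N. H d) = e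
   | Suc n \<Rightarrow> \<exists>p. degree p \<le> n \<and> fact n * coeff p n = e \<and> (\<forall>\<^sub>F d in sequentially. H d = poly p (real d)))"

lemma poly_shift_exists:
  fixes p :: "real poly"
  assumes "degree p \<le> n"
  shows "\<exists>q. degree q \<le> n \<and> coeff q n = coeff p n \<and> (\<forall>x. poly q x = poly p (x - a))"
proof (intro exI[of _ "pcompose p [:- a, 1:]"] conjI allI)
  have deg: "degree (pcompose p [:- a, 1:]) = degree p" by (simp add: degree_pcompose)
  then show "degree (pcompose p [:- a, 1:]) \<le> n" using assms by simp
  show "coeff (pcompose p [:- a, 1:]) n = coeff p n"
  proof (cases "degree p = n")
    case True
    then show ?thesis using lead_coeff_comp[of "[:- a, 1:]" p] deg by simp
  next
    case False
    then show ?thesis using deg assms by (simp add: coeff_eq_0)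
  qed
qed (simp add: poly_pcompose)

text \<open>For \<open>p = c + x p'\<close> the difference is
  \<open>x (p'(x) - p'(x - a)) + a p'(x - a)\<close>. The second summand contributes one more
  \<open>a\<close> to the factor of the top coefficient at every step of the induction.\<close>

lemma poly_difference_exists:
  fixes p :: "real poly"
  assumes "degree p \<le> Suc n"
  shows "\<exists>q. degree q \<le> n \<and> coeff q n = a * real (Suc n) * coeff p (Suc n) \<and>
    (\<forall>x. poly q x = poly p x - poly p (x - a))"
  using assms
proof (induction n arbitrary: p)
  case 0
  obtain c p' where p: "p = pCons c p'" by (cases p)
  have "degree p' = 0" using 0 p by (auto split: if_splits)
  then obtain b where "p' = [:b:]" by (metis degree_0_id)
  then show ?case using p by (intro exI[of _ "[:a * b:]"]) (auto simp: algebra_simps)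
next
  case (Suc n)
  obtain c p' where p: "p = pCons c p'" by (cases p)
  have deg: "degree p' \<le> Suc n" using Suc.prems p by (auto split: if_splits)
  obtain q' where q': "degree q' \<le> n" "coeff q' n = a * real (Suc n) * coeff p' (Suc n)"
    "\<And>x. poly q' x = poly p' x - poly p' (x - a)"
    using Suc.IH[OF deg] by blast
  obtain t where t: "degree t \<le> Suc n" "coeff t (Suc n) = coeff p' (Suc n)"
    "\<And>x. poly t x = poly p' (x - a)"
    using poly_shift_exists[OF deg] by blast
  let ?q = "pCons 0 q' + Polynomial.smult a t"
  have "degree ?q \<le> Suc n"
    using q'(1) t(1) by (intro degree_add_le degree_smult_le[THEN order_trans]) (auto simp: degree_pCons_eq_if)
  moreover have "coeff ?q (Suc n) = a * real (Suc (Suc n)) * coeff p (Suc (Suc n))"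
    using q'(2) t(2) by (simp add: p algebra_simps)
  moreover have "poly ?q x = poly p x - poly p (x - a)" for x
    by (simp add: p q'(3) t(3) algebra_simps)
  ultimately show ?case by blast
qed

lemma sum_shift: "(\<Sum>d<N + a. shift a H d) = (\<Sum>d<N. H d)"
  by (induction N) (auto simp: shift_def)

lemma has_mult_zero: "has_mult \<delta> 0 (\<lambda>d. 0)"
  by (auto simp: has_mult_def split: nat.split intro!: exI[of _ 0])

lemma has_mult_add:
  assumes "has_mult \<delta> e H" "has_mult \<delta> e' H'"
  shows "has_mult \<delta> (e + e') (\<lambda>d. H d + H' d)"
proof (cases \<delta>)
  case 0
  then have "\<forall>\<^sub>F N in sequentially. H N = 0 \<and> (\<Sum>d<N. H d) = e"
    "\<forall>\<^sub>F N in sequentially. H' N = 0 \<and> (\<Sum>d<N. H' d) = e'"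
    using assms by (simp_all add: has_mult_def)
  then have "\<forall>\<^sub>F N in sequentially. H N + H' N = 0 \<and> (\<Sum>d<N. H d + H' d) = e + e'"
    by eventually_elim (simp add: sum.distrib)
  then show ?thesis using 0 by (simp add: has_mult_def)
next
  case (Suc n)
  obtain p where p: "degree p \<le> n" "fact n * coeff p n = e" "\<forall>\<^sub>F d in sequentially. H d = poly p (real d)"
    using assms(1) by (auto simp: has_mult_def Suc)
  obtain q where q: "degree q \<le> n" "fact n * coeff q n = e'" "\<forall>\<^sub>F d in sequentially. H' d = poly q (real d)"
    using assms(2) by (auto simp: has_mult_def Suc)
  have "\<forall>\<^sub>F d in sequentially. H d + H' d = poly (p + q) (real d)"
    using p(3) q(3) by eventually_elim simp
  moreover have "degree (p + q) \<le> n" using p q by (intro degree_add_le)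
  moreover have "fact n * coeff (p + q) n = e + e'" using p q by (simp add: algebra_simps)
  ultimately show ?thesis unfolding has_mult_def Suc nat.case by blast
qed

lemma eventually_shift:
  assumes "\<forall>\<^sub>F d in sequentially. H d = h d"
  shows "\<forall>\<^sub>F d in sequentially. a \<le> d \<and> shift a H d = h (d - a)"
proof -
  have "\<forall>\<^sub>F d in sequentially. a \<le> d + a \<and> shift a H (d + a) = h (d + a - a)"
    using assms by eventually_elim (simp add: shift_def)
  then show ?thesis by (rule eventually_sequentially_seg[THEN iffD1])
qed

lemma has_mult_shift:
  assumes "has_mult \<delta> e H"
  shows "has_mult \<delta> e (shift a H)"
proof (cases \<delta>)
  case 0
  then have "\<forall>\<^sub>F N in sequentially. H N = 0 \<and> (\<Sum>d<N. H d) = e"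
    using assms by (simp add: has_mult_def)
  then have "\<forall>\<^sub>F N in sequentially. shift a H (N + a) = 0 \<and> (\<Sum>d<N + a. shift a H d) = e"
    by eventually_elim (simp only: sum_shift, simp add: shift_def)
  then have "\<forall>\<^sub>F N in sequentially. shift a H N = 0 \<and> (\<Sum>d<N. shift a H d) = e"
    by (rule eventually_sequentially_seg[THEN iffD1])
  then show ?thesis using 0 by (simp add: has_mult_def)
next
  case (Suc n)
  obtain p where p: "degree p \<le> n" "fact n * coeff p n = e" "\<forall>\<^sub>F d in sequentially. H d = poly p (real d)"
    using assms by (auto simp: has_mult_def Suc)
  obtain q where q: "degree q \<le> n" "coeff q n = coeff p n" "\<And>x. poly q x = poly p (x - real a)"
    using poly_shift_exists[OF p(1)] by blast
  have "\<forall>\<^sub>F d in sequentially. shift a H d = poly q (real d)"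
    using eventually_shift[OF p(3), of a] by eventually_elim (simp add: q of_nat_diff)
  then show ?thesis unfolding has_mult_def Suc nat.case using p q by metis
qed

text \<open>For positive \<delta> the factor \<open>a * \<delta>\<close> of the differenced top
  coefficient is absorbed by passing from the factorial of \<delta> to that of \<delta> - 1. For
  \<delta> = 0 the function \<open>H\<close> is eventually the constant \<open>e\<close>, and the
  sum of differences telescopes to its last \<open>a\<close> values.\<close>

lemma has_mult_difference:
  assumes "has_mult (Suc \<delta>) e H"
  shows "has_mult \<delta> (real a * e) (\<lambda>d. H d - shift a H d)"
proof -
  obtain p where p: "degree p \<le> \<delta>" "fact \<delta> * coeff p \<delta> = e" "\<forall>\<^sub>F d in sequentially. H d = poly p (real d)"
    using assms by (auto simp: has_mult_def)
  show ?thesis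
  proof (cases \<delta>)
    case 0
    then obtain b where "p = [:b:]" using p(1) by (metis degree_0_id le_zero_eq)
    then have c: "poly p x = e" for x using p(2) 0 by simp
    obtain M where M: "\<And>d. d \<ge> M \<Longrightarrow> H d = e"
      using p(3) by (auto simp: eventually_sequentially c)
    have "H (N + a) - shift a H (N + a) = 0 \<and> (\<Sum>d<N + a. H d - shift a H d) = real a * e" if "N \<ge> M" for N
    proof -
      have "(\<Sum>d<N + a. H d) = (\<Sum>d<N. H d) + real a * e"
        using that by (induction a) (auto simp: M algebra_simps)
      then show ?thesis using that by (simp add: sum_subtractf sum_shift M) (simp add: shift_def M)
    qed
    then have "\<forall>\<^sub>F N in sequentially. H (N + a) - shift a H (N + a) = 0 \<and>
        (\<Sum>d<N + a. H d - shift a H d) = real a * e"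
      unfolding eventually_sequentially by blast
    then have "\<forall>\<^sub>F N in sequentially. H N - shift a H N = 0 \<and>
        (\<Sum>d<N. H d - shift a H d) = real a * e"
      by (rule eventually_sequentially_seg[THEN iffD1])
    then show ?thesis using 0 by (simp add: has_mult_def)
  next
    case (Suc n)
    obtain q where q: "degree q \<le> n" "coeff q n = real a * real (Suc n) * coeff p (Suc n)"
      "\<And>x. poly q x = poly p x - poly p (x - real a)"
      using poly_difference_exists[of p n "real a"] p(1) Suc by blast
    have "\<forall>\<^sub>F d in sequentially. H d - shift a H d = poly q (real d)"
      using p(3) eventually_shift[OF p(3), of a] by eventually_elim (simp add: q of_nat_diff)
    moreover have "fact n * coeff q n = real a * e"
      unfolding p(2)[symmetric] q(2) Suc by simp
    ultimately show ?thesis unfolding has_mult_def Suc nat.case using q(1) by blast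
  qed
qed

abbreviation hilbert :: "('x::finite, 'k::field) mpoly set \<Rightarrow> nat \<Rightarrow> real" where
  "hilbert A \<equiv> \<lambda>d. real (hilbert_function (ideal_gen A) d)"

lemma rising_factorial_poly:
  "\<exists>p :: real poly. degree p = n \<and> lead_coeff p = 1 \<and> (\<forall>x. poly p x = pochhammer (x + 1) n)"
proof (induction n)
  case 0
  show ?case by (intro exI[of _ 1]) auto
next
  case (Suc n)
  then obtain p :: "real poly" where p: "degree p = n" "lead_coeff p = 1" "\<And>x. poly p x = pochhammer (x + 1) n"
    by blast
  let ?q = "p * [:1 + real n, 1:]"
  have "p \<noteq> 0" using p(2) by auto
  then have "degree ?q = Suc n" by (subst degree_mult_eq) (auto simp: p(1))
  moreover have "lead_coeff ?q = 1" unfolding lead_coeff_mult p(2) by simp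
  moreover have "poly ?q x = pochhammer (x + 1) (Suc n)" for x
    by (simp add: p(3) pochhammer_Suc algebra_simps)
  ultimately show ?case by blast
qed

text \<open>With \<open>n + 1\<close> variables the Hilbert function is
  \<open>binom(d + n, n)\<close>, a polynomial in \<open>d\<close> with leading coefficient
  \<open>1 / n!\<close>.\<close>

lemma has_mult_mpoly:
  "has_mult CARD('x) 1 (hilbert ({} :: ('x::finite, 'k::field) mpoly set))"
proof -
  obtain n where n: "CARD('x) = Suc n" using gr0_conv_Suc by (metis finite_UNIV_card_ge_0 finite)
  obtain p :: "real poly" where p: "degree p = n" "lead_coeff p = 1" "\<And>x. poly p x = pochhammer (x + 1) n"
    using rising_factorial_poly by blast
  let ?q = "Polynomial.smult (1 / fact n) p"
  have "hilbert ({} :: ('x, 'k) mpoly set) d = poly ?q (real d)" for d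
  proof -
    have "hilbert ({} :: ('x, 'k) mpoly set) d = real ((d + n) choose n)"
      using binomial_symmetric[of d "d + n"] by (simp add: hilbert_function_zero n)
    also have "\<dots> = pochhammer (real d + 1) n / fact n"
      unfolding binomial_gbinomial gbinomial_pochhammer' by (simp add: add.commute)
    finally show ?thesis by (simp add: p)
  qed
  then show ?thesis unfolding has_mult_def n nat.case
    using p by (intro exI[of _ ?q]) auto
qed

lemma hilbert_nzd:
  assumes "homog_set A" "f \<in> graded_part (int a)" "nzd A f"
  shows "hilbert (insert f A) = (\<lambda>d. hilbert A d - shift a (hilbert A) d)"
proof
  fix d
  have "f * g \<in> ideal_gen A \<longleftrightarrow> g \<in> ideal_gen A" for g
    using nzdD[OF assms(3)] ideal_gen_mult by blast
  from hilbert_function_colon[OF assms(1,2) this, of d]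
  show "hilbert (insert f A) d = hilbert A d - shift a (hilbert A) d" by (simp add: shift_def)
qed

text \<open>A module of finite length and its twist have the same total length, so the quotient by
  \<open>f\<close> has length 0. This shows that a proper regular sequence is no longer than the
  dimension, so that \<open>\<delta> - length fs\<close> is a true difference.\<close>

lemma no_nzd_if_finite_length:
  assumes A: "homog_set A" and f: "f \<in> graded_part (int a)" "nzd A f" and fin: "has_mult 0 e (hilbert A)"
  shows "ideal_gen (insert f A) = UNIV"
proof (rule ccontr)
  assume "ideal_gen (insert f A) \<noteq> UNIV"
  then have pos: "hilbert (insert f A) 0 > 0"
    using hilbert_function_0_pos[OF homog_set_insert[OF f(1) A]] by simp
  have "\<forall>\<^sub>F N in sequentially. (\<Sum>d<N. hilbert A d) = e \<and> (\<Sum>d<N. shift a (hilbert A) d) = e"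
    using fin has_mult_shift[OF fin, of a] unfolding has_mult_def nat.case by eventually_elim simp
  then have "\<forall>\<^sub>F N in sequentially. (\<Sum>d<N. hilbert (insert f A) d) = 0 \<and> N > 0"
    using eventually_gt_at_top[of 0]
    by eventually_elim (simp add: fun_cong[OF hilbert_nzd[OF A f]] sum_subtractf)
  then obtain N where N: "(\<Sum>d<N. hilbert (insert f A) d) = 0" "N > 0"
    using eventually_happens'[OF sequentially_bot] by blast
  then have "hilbert (insert f A) 0 = 0" using sum_nonneg_eq_0_iff[of "{..<N}" "hilbert (insert f A)"] by simp
  then show False using pos by simp
qed

lemma has_mult_reg_seq:
  assumes "homog_set A" "reg_seq A fs" "list_all2 (\<lambda>f d. f \<in> graded_part (int d)) fs ds"
    "ideal_gen (set fs \<union> A) \<noteq> UNIV" "has_mult \<delta> e (hilbert A)"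
  shows "length fs \<le> \<delta> \<and> has_mult (\<delta> - length fs) (e * real (prod_list ds)) (hilbert (set fs \<union> A))"
  using assms
proof (induction fs arbitrary: A ds \<delta> e)
  case (Cons f fs)
  then obtain a ds' where ds: "ds = a # ds'" and a: "f \<in> graded_part (int a)"
    and ds': "list_all2 (\<lambda>f d. f \<in> graded_part (int d)) fs ds'"
    by (auto simp: list_all2_Cons1)
  have f: "nzd A f" and r: "reg_seq (insert f A) fs" using Cons.prems by auto
  note hom = homog_set_insert[OF a Cons.prems(1)]
  have proper: "ideal_gen (set fs \<union> insert f A) \<noteq> UNIV" using Cons.prems(4) by simp
  have "\<delta> \<noteq> 0"
  proof
    assume "\<delta> = 0"
    then have "ideal_gen (insert f A) = UNIV"
      using no_nzd_if_finite_length[OF Cons.prems(1) a f] Cons.prems(5) by simp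
    then show False
      using ideal.span_mono[of "insert f A" "set fs \<union> insert f A"] proper by auto
  qed
  then obtain \<gamma> where \<gamma>: "\<delta> = Suc \<gamma>" by (cases \<delta>) auto
  have "has_mult \<gamma> (real a * e) (hilbert (insert f A))"
    unfolding hilbert_nzd[OF Cons.prems(1) a f]
    by (rule has_mult_difference) (use Cons.prems(5) \<gamma> in simp)
  from Cons.IH[OF hom r ds' proper this] show ?case by (simp add: \<gamma> ds algebra_simps)
qed simp

lemma homog_set_list_all2:
  "list_all2 (\<lambda>f d. f \<in> graded_part (int d)) fs ds \<Longrightarrow> homog_set (set fs)"
  by (induction rule: list_all2_induct) (auto intro: homog_set_insert)

text \<open>Multiplication by \<open>t\<close> splits the Hilbert function for exponent
  \<open>s + 1\<close> into that of the power of \<open>T\<close> modulo \<open>t\<close> and a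
  twist of the one for exponent \<open>s\<close>. Twisting preserves the multiplicity in dimension
  \<delta>, so the two add up by Pascal's rule. The case \<open>s = 0\<close>,
  \<open>fs = []\<close> is excluded because truncated subtraction gives the binomial 1 there, while
  the quotient is 0.\<close>

lemma has_mult_prod_gens:
  assumes "homog_set A" "perm_reg_seq A fs" "list_all2 (\<lambda>f d. f \<in> graded_part (int d)) fs ds"
    "has_mult \<delta> e (hilbert (set fs \<union> A))" "s > 0 \<or> fs \<noteq> []"
  shows "has_mult \<delta> (e * real ((s + length fs - 1) choose length fs)) (hilbert (A \<union> prod_gens (set fs) s))"
  using assms
proof (induction fs arbitrary: A ds s)
  case Nil
  then obtain m where "s = Suc m" by (cases s) auto
  then show ?case using Nil by simp
next
  case (Cons t T)
  obtain a ds' where ds: "ds = a # ds'" and a: "t \<in> graded_part (int a)"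
    and ds': "list_all2 (\<lambda>f d. f \<in> graded_part (int d)) T ds'"
    using Cons.prems(3) by (auto simp: list_all2_Cons1)
  show ?case
  proof (induction s)
    case 0
    \<comment> \<open>The quotient is 0, in agreement with the binomial, whose lower index exceeds
      the upper one.\<close>
    have "ideal_gen (A \<union> {1}) = UNIV" by (subst ideal_gen_eq_UNIV_iff) (auto intro: ideal.span_base)
    then show ?case by (simp add: hilbert_function_UNIV has_mult_zero binomial_eq_0)
  next
    case (Suc s)
    let ?E = "\<lambda>s. A \<union> prod_gens (set (t # T)) s"
    have "homog_set (set (t # T))"
      using Cons.prems(3) by (rule homog_set_list_all2)
    then have E: "homog_set (?E (Suc s))"
      by (intro homog_set_Un Cons.prems(1) homog_set_prod_gens)
    have "has_mult \<delta> (e * real ((Suc s + length T - 1) choose length T))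
        (hilbert (insert t A \<union> prod_gens (set T) (Suc s)))"
      using Cons.prems(4)
      by (intro Cons.IH[OF homog_set_insert[OF a Cons.prems(1)] perm_reg_seq_insert[OF Cons.prems(2)] ds']) auto
    moreover have "hilbert (insert t A \<union> prod_gens (set T) (Suc s)) = hilbert (insert t (?E (Suc s)))"
      by (simp only: list.set ideal_gen_insert_prod_gens)
    moreover note has_mult_shift[OF Suc.IH, of a]
    ultimately have "has_mult \<delta> (e * real ((Suc s + length T - 1) choose length T) +
        e * real ((s + length (t # T) - 1) choose length (t # T)))
      (\<lambda>d. hilbert (insert t (?E (Suc s))) d + shift a (hilbert (?E s)) d)"
      by (intro has_mult_add) simp_all
    moreover have "(\<lambda>d. hilbert (insert t (?E (Suc s))) d + shift a (hilbert (?E s)) d) = hilbert (?E (Suc s))"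
      using hilbert_function_colon[OF E a prod_gens_colon[OF Cons.prems(2)]] by (simp add: shift_def fun_eq_iff)
    moreover have "e * real ((Suc s + length T - 1) choose length T) +
        e * real ((s + length (t # T) - 1) choose length (t # T)) =
      e * real ((Suc s + length (t # T) - 1) choose length (t # T))"
      by (simp add: algebra_simps)
    ultimately show ?case by simp
  qed
qed

section \<open>From eventual behaviour to the multiplicity\<close>

lemma poly_eqI_eventually:
  fixes P Q :: "real poly"
  assumes "\<forall>\<^sub>F d in sequentially. poly P (real d) = poly Q (real d)"
  shows "P = Q"
proof (rule ccontr)
  assume "P \<noteq> Q"
  then have fin: "finite {x. poly (P - Q) x = 0}" by (intro poly_roots_finite) simp
  obtain N where "\<And>d. d \<ge> N \<Longrightarrow> poly P (real d) = poly Q (real d)"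
    using assms by (auto simp: eventually_sequentially)
  then have "real ` {N..} \<subseteq> {x. poly (P - Q) x = 0}" by auto
  then have "finite (real ` {N..})" using fin finite_subset by blast
  then have "finite {N..}" by (rule finite_imageD) (simp add: inj_on_def)
  then show False by (simp add: infinite_Ici)
qed

lemma hilbert_polynomial_eqI:
  assumes "\<forall>\<^sub>F d in sequentially. real (hilbert_function J d) = poly P (real d)"
  shows "hilbert_polynomial J = P"
  unfolding hilbert_polynomial_def
proof (rule the_equality)
  show "\<forall>\<^sub>F d in sequentially. real (hilbert_function J d) = poly P (real d)" by (rule assms)
  fix Q assume "\<forall>\<^sub>F d in sequentially. real (hilbert_function J d) = poly Q (real d)"
  with assms have "\<forall>\<^sub>F d in sequentially. poly Q (real d) = poly P (real d)"
    by eventually_elim simp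
  then show "Q = P" by (rule poly_eqI_eventually)
qed

text \<open>In positive dimension \<open>e > 0\<close> makes the top coefficient nonzero, so the
  degree bound in \<open>has_mult\<close> is attained and the leading coefficient is the one
  recorded.\<close>

lemma quotient_multiplicity_eqI:
  assumes "has_mult \<delta> e (\<lambda>d. real (hilbert_function J d))" "e > 0"
  shows "quotient_multiplicity J = e"
proof (cases \<delta>)
  case 0
  then have ev: "\<forall>\<^sub>F N in sequentially. real (hilbert_function J N) = 0 \<and> (\<Sum>d<N. real (hilbert_function J d)) = e"
    using assms(1) by (simp add: has_mult_def)
  then have "\<forall>\<^sub>F d in sequentially. real (hilbert_function J d) = poly 0 (real d)"
    by eventually_elim simp
  then have P: "hilbert_polynomial J = 0" by (rule hilbert_polynomial_eqI)
  obtain N where N: "\<And>n. n \<ge> N \<Longrightarrow> hilbert_function J n = 0" "(\<Sum>d<N. real (hilbert_function J d)) = e"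
    using ev unfolding eventually_sequentially by auto
  have "(\<Sum>d | hilbert_function J d \<noteq> 0. real (hilbert_function J d)) = (\<Sum>d<N. real (hilbert_function J d))"
    using N(1) by (intro sum.mono_neutral_left) (auto intro: ccontr)
  then show ?thesis by (simp add: quotient_multiplicity_def P N(2))
next
  case (Suc n)
  then obtain p where p: "degree p \<le> n" "fact n * coeff p n = e"
    "\<forall>\<^sub>F d in sequentially. real (hilbert_function J d) = poly p (real d)"
    using assms(1) by (auto simp: has_mult_def)
  have "hilbert_polynomial J = p" using p(3) by (rule hilbert_polynomial_eqI)
  moreover have "coeff p n \<noteq> 0" using p(2) assms(2) by auto
  then have "p \<noteq> 0" "degree p = n" using p(1) le_degree[of p n] by auto
  ultimately show ?thesis using p(2) by (simp add: quotient_multiplicity_def)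
qed

theorem quotient_multiplicity_power:
  fixes fs :: "('x::finite, 'k::field) mpoly list"
  assumes perm: "perm_reg_seq {} fs" and deg: "list_all2 (\<lambda>f d. f \<in> graded_part (int d)) fs ds"
    and pos: "\<forall>d\<in>set ds. d > 0" and proper: "ideal_gen (set fs) \<noteq> UNIV" and s: "s > 0"
  shows "quotient_multiplicity (ideal_gen (prod_gens (set fs) s)) =
    real (((s + length fs - 1) choose length fs) * prod_list ds)"
proof (rule quotient_multiplicity_eqI)
  have "reg_seq {} fs" using perm_reg_seq_imp[OF perm] by simp
  then have "has_mult (CARD('x) - length fs) (real (prod_list ds)) (hilbert (set fs))"
    using has_mult_reg_seq[OF _ _ deg _ has_mult_mpoly] proper by simp
  then show "has_mult (CARD('x) - length fs) (real (((s + length fs - 1) choose length fs) * prod_list ds))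
      (hilbert (prod_gens (set fs) s))"
    using has_mult_prod_gens[OF _ perm deg, of "CARD('x) - length fs" "real (prod_list ds)" s] s
    by (simp add: mult.commute)
  have "prod_list ds > 0" using pos by (induction ds) auto
  moreover have "(s + length fs - 1) choose length fs > 0" using s by (intro zero_less_binomial) simp
  ultimately show "real (((s + length fs - 1) choose length fs) * prod_list ds) > 0" by simp
qed

section \<open>Shifts occurring in a graded free resolution of a power\<close>

text \<open>
  Elements of a free module of rank \<open>n\<close> are represented by functions supported on \<open>{..<n}\<close>, so that
  the linear operators of the Koszul section apply to them.
\<close>

definition mat_op :: "'a::comm_ring_1 mat \<Rightarrow> (nat \<Rightarrow> 'a) \<Rightarrow> nat \<Rightarrow> 'a" where
  "mat_op M x j = (if j < dim_row M then \<Sum>l<dim_col M. M $$ (j, l) * x l else 0)"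

definition supported :: "nat \<Rightarrow> (nat \<Rightarrow> 'a::zero) set" where
  "supported n = {x. \<forall>l\<ge>n. x l = 0}"

definition unit_fun :: "nat \<Rightarrow> nat \<Rightarrow> 'a::comm_ring_1" where
  "unit_fun l k = (if k = l then 1 else 0)"

lemma supported_unit_fun: "l < n \<Longrightarrow> unit_fun l \<in> supported n"
  by (auto simp: supported_def unit_fun_def)

lemma supported_expand:
  assumes "x \<in> supported n"
  shows "x = (\<lambda>i. \<Sum>l<n. x l * unit_fun l i)"
proof
  fix i
  have "(\<Sum>l<n. x l * unit_fun l i) = (\<Sum>l<n. if l = i then x l else 0)"
    by (intro sum.cong) (auto simp: unit_fun_def)
  then show "x i = (\<Sum>l<n. x l * unit_fun l i)"
    using assms by (auto simp: supported_def)
qed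

lemma linear_op_mat_op: "linear_op (mat_op M)"
  by (auto simp: linear_op_def mat_op_def fun_eq_iff sum.distrib sum_distrib_left algebra_simps)

lemma mat_op_supported: "mat_op M x \<in> supported (dim_row M)"
  by (simp add: supported_def mat_op_def)

lemma mat_op_unit_fun:
  assumes "j < dim_row M" "l < dim_col M"
  shows "mat_op M (unit_fun l) j = M $$ (j, l)"
  using assms by (simp add: mat_op_def unit_fun_def if_distrib[where f = "\<lambda>c. _ * c"] cong: if_cong)

lemma mat_op_vec:
  assumes "j < dim_row M"
  shows "(M *\<^sub>v vec (dim_col M) x) $ j = mat_op M x j"
  using assms by (simp add: scalar_prod_def mat_op_def atLeast0LessThan)

text \<open>Homogeneous elements of degree \<open>N\<close> in the graded free module with shifts
  \<open>E\<close>.\<close>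

definition homog_vec :: "int list \<Rightarrow> int \<Rightarrow> (nat \<Rightarrow> ('x::finite, 'k::comm_ring_1) mpoly) \<Rightarrow> bool" where
  "homog_vec E N x \<longleftrightarrow> (\<forall>l<length E. x l \<in> graded_part (N - E ! l))"

text \<open>A degree-preserving map commutes with taking components; hence a preimage of a
  homogeneous vector can be made homogeneous.\<close>

lemma mat_op_hcomp:
  assumes M: "M \<in> carrier_mat (length E') (length E)"
    and M_graded: "\<forall>j<length E'. \<forall>l<length E. M $$ (j, l) \<in> graded_part (E ! l - E' ! j)"
    and x: "homog_vec E' N (mat_op M y)"
  shows "mat_op M (\<lambda>l. hcomp (N - E ! l) (y l)) = mat_op M y"
proof
  fix j
  show "mat_op M (\<lambda>l. hcomp (N - E ! l) (y l)) j = mat_op M y j"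
  proof (cases "j < length E'")
    case True
    have "mat_op M (\<lambda>l. hcomp (N - E ! l) (y l)) j =
      (\<Sum>l<length E. M $$ (j, l) * hcomp (N - E ! l) (y l))"
      using True M by (simp add: mat_op_def)
    also have "\<dots> = (\<Sum>l<length E. hcomp (N - E' ! j) (M $$ (j, l) * y l))"
    proof (intro sum.cong refl)
      fix l assume "l \<in> {..<length E}"
      then have "M $$ (j, l) \<in> graded_part (E ! l - E' ! j)" using M_graded True by simp
      from hcomp_mult[OF this, of "N - E' ! j" "y l"]
      show "M $$ (j, l) * hcomp (N - E ! l) (y l) = hcomp (N - E' ! j) (M $$ (j, l) * y l)"
        by (simp add: algebra_simps)
    qed
    also have "\<dots> = hcomp (N - E' ! j) (mat_op M y j)"
      using True M by (simp add: mat_op_def hcomp_sum)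
    also have "\<dots> = mat_op M y j"
      using x True by (simp add: homog_vec_def hcomp_of_graded[of _ "N - E' ! j"])
    finally show ?thesis .
  qed (use M in \<open>simp add: mat_op_def\<close>)
qed

definition res_cycle :: "'a::comm_ring_1 set \<Rightarrow> (nat \<Rightarrow> 'a mat) \<Rightarrow> nat \<Rightarrow> (nat \<Rightarrow> 'a) \<Rightarrow> bool" where
  "res_cycle J \<phi> p x \<longleftrightarrow> (if p = 0 then x 0 \<in> J else mat_op (\<phi> p) x = (\<lambda>_. 0))"

section \<open>Exactness of the resolution and comparison maps\<close>

locale graded_resolution =
  fixes J :: "('x::finite, 'k::comm_ring_1) mpoly set" and r D \<phi>
  assumes res: "graded_free_resolution J r D \<phi>"
begin

abbreviation rank :: "nat \<Rightarrow> nat" where "rank i \<equiv> length (D i)"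

lemma D_0: "D 0 = [0]" and D_Suc_r: "D (Suc r) = []"
  using res by (auto simp: graded_free_resolution_def)

lemma phi_carrier: "p \<le> r \<Longrightarrow> \<phi> (Suc p) \<in> carrier_mat (rank p) (rank (Suc p))"
  using res by (auto simp: graded_free_resolution_def dest: bspec[of _ _ "Suc p"])

lemma phi_graded:
  "p \<le> r \<Longrightarrow> \<forall>j<rank p. \<forall>l<rank (Suc p). \<phi> (Suc p) $$ (j, l) \<in> graded_part (D (Suc p) ! l - D p ! j)"
  using res by (auto simp: graded_free_resolution_def dest: bspec[of _ _ "Suc p"])

lemma exact:
  assumes "p \<le> r" "x \<in> supported (rank p)" "res_cycle J \<phi> p x"
  shows "\<exists>y\<in>supported (rank (Suc p)). mat_op (\<phi> (Suc p)) y = x"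
proof -
  let ?x = "vec (rank p) x"
  have "\<exists>v\<in>carrier_vec (rank (Suc p)). \<phi> (Suc p) *\<^sub>v v = ?x"
  proof (cases p)
    case 0
    then have "x 0 \<in> (\<lambda>v. (\<phi> 1 *\<^sub>v v) $ 0) ` carrier_vec (length (D 1))"
      using assms(3) res by (simp add: res_cycle_def graded_free_resolution_def)
    then obtain v where v: "v \<in> carrier_vec (length (D 1))" "x 0 = (\<phi> 1 *\<^sub>v v) $ 0" by auto
    have "\<phi> 1 *\<^sub>v v = ?x"
      using v(2) phi_carrier[of 0] 0 by (intro eq_vecI) (auto simp: D_0)
    then show ?thesis using v 0 by auto
  next
    case (Suc q)
    have phi: "\<phi> p \<in> carrier_mat (rank q) (rank p)" using phi_carrier[of q] assms(1) Suc by simp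
    have "\<phi> p *\<^sub>v ?x = 0\<^sub>v (rank q)"
    proof (rule eq_vecI)
      fix j assume "j < dim_vec (0\<^sub>v (rank q))"
      then show "(\<phi> p *\<^sub>v ?x) $ j = 0\<^sub>v (rank q) $ j"
        using mat_op_vec[of j "\<phi> p" x] phi assms(3) Suc by (simp add: res_cycle_def)
    qed (use phi in auto)
    then have "?x \<in> mat_kernel (\<phi> p)" using phi by (simp add: mat_kernel_def)
    moreover have "p \<in> {1..r}" using assms(1) Suc by simp
    ultimately have "?x \<in> (\<lambda>v. \<phi> (Suc p) *\<^sub>v v) ` carrier_vec (length (D (Suc p)))"
      using res unfolding graded_free_resolution_def by blast
    then show ?thesis by auto
  qed
  then obtain v where v: "v \<in> carrier_vec (rank (Suc p))" "\<phi> (Suc p) *\<^sub>v v = ?x" by auto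
  let ?y = "\<lambda>l. if l < rank (Suc p) then v $ l else 0"
  have v_eq: "v = vec (dim_col (\<phi> (Suc p))) ?y"
    using v(1) phi_carrier[OF assms(1)] by (intro eq_vecI) auto
  have "mat_op (\<phi> (Suc p)) ?y j = x j" for j
  proof (cases "j < rank p")
    case True
    then have "mat_op (\<phi> (Suc p)) ?y j = (\<phi> (Suc p) *\<^sub>v v) $ j"
      using mat_op_vec[of j "\<phi> (Suc p)" ?y] phi_carrier[OF assms(1)] unfolding v_eq[symmetric] by simp
    then show ?thesis using v(2) True by simp
  qed (use phi_carrier[OF assms(1)] assms(2) in \<open>simp add: mat_op_def supported_def\<close>)
  then show ?thesis by (intro bexI[of _ ?y]) (auto simp: supported_def)
qed

lemma exact_graded:
  assumes "p \<le> r" "x \<in> supported (rank p)" "res_cycle J \<phi> p x" "homog_vec (D p) N x"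
  shows "\<exists>y\<in>supported (rank (Suc p)). homog_vec (D (Suc p)) N y \<and> mat_op (\<phi> (Suc p)) y = x"
proof -
  obtain y where y: "y \<in> supported (rank (Suc p))" "mat_op (\<phi> (Suc p)) y = x"
    using exact[OF assms(1-3)] by auto
  let ?y = "\<lambda>l. hcomp (N - D (Suc p) ! l) (y l)"
  have "mat_op (\<phi> (Suc p)) ?y = x"
    using mat_op_hcomp[OF phi_carrier[OF assms(1)] phi_graded[OF assms(1)], of N y] assms(4) y(2) by simp
  moreover have "?y \<in> supported (rank (Suc p))" using y(1) by (simp add: supported_def)
  moreover have "homog_vec (D (Suc p)) N ?y" by (simp add: homog_vec_def hcomp_graded)
  ultimately show ?thesis by blast
qed

lemma image_is_cycle:
  assumes "p \<le> r"
  shows "res_cycle J \<phi> p (mat_op (\<phi> (Suc p)) y)"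
proof (cases p)
  case 0
  have "mat_op (\<phi> 1) y 0 = (\<phi> 1 *\<^sub>v vec (rank 1) y) $ 0"
    using mat_op_vec[of 0 "\<phi> 1" y] phi_carrier[of 0] by (simp add: D_0)
  also have "\<dots> \<in> J" using res unfolding graded_free_resolution_def by auto
  finally show ?thesis using 0 by (simp add: res_cycle_def)
next
  case (Suc q)
  let ?v = "\<phi> (Suc p) *\<^sub>v vec (rank (Suc p)) y"
  have phi: "\<phi> p \<in> carrier_mat (rank q) (rank p)" using phi_carrier[of q] assms(1) Suc by simp
  have phi': "\<phi> (Suc p) \<in> carrier_mat (rank p) (rank (Suc p))" using phi_carrier[OF assms] .
  have "p \<in> {1..r}" using assms Suc by simp
  then have "?v \<in> mat_kernel (\<phi> p)"
    using res unfolding graded_free_resolution_def by auto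
  then have ker: "\<phi> p *\<^sub>v ?v = 0\<^sub>v (rank q)" using phi by (simp add: mat_kernel_def)
  have v_eq: "?v = vec (dim_col (\<phi> p)) (mat_op (\<phi> (Suc p)) y)"
    using phi phi' mat_op_vec[of _ "\<phi> (Suc p)" y] by (intro eq_vecI) auto
  have "mat_op (\<phi> p) (mat_op (\<phi> (Suc p)) y) j = 0" for j
  proof (cases "j < rank q")
    case True
    then have "mat_op (\<phi> p) (mat_op (\<phi> (Suc p)) y) j = (\<phi> p *\<^sub>v ?v) $ j"
      using mat_op_vec[of j "\<phi> p"] phi unfolding v_eq by simp
    then show ?thesis using ker True by simp
  qed (use phi in \<open>simp add: mat_op_def\<close>)
  then show ?thesis using Suc by (auto simp: res_cycle_def)
qed

text \<open>The comparison theorem: the resolution is free and the augmented Koszul complex exact,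
  so a lift is chosen on unit vectors and extended linearly. The inclusion of \<open>J\<close>
  starts it in degree 0.\<close>

lemma chain_map_to_koszul:
  assumes "koszul_regular fs" "J \<subseteq> ideal_gen (set fs)" "n \<le> Suc r"
  shows "\<exists>\<Psi>. (\<forall>p. linear_op (\<Psi> p)) \<and>
    (\<forall>x. \<Psi> 0 x = (\<lambda>v. if v = replicate (length fs) False then x 0 else 0)) \<and>
    (\<forall>p<n. \<forall>x. \<Psi> p x \<in> koszul_chains (length fs) p) \<and>
    (\<forall>p. Suc p < n \<longrightarrow> (\<forall>x\<in>supported (rank (Suc p)).
      koszul_bd fs (\<Psi> (Suc p) x) = \<Psi> p (mat_op (\<phi> (Suc p)) x)))"
  using assms(3)
proof (induction n)
  case 0
  \<comment> \<open>Every degree starts with the same linear placeholder; the induction keeps it in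
    degree 0 and overwrites the later degrees one at a time.\<close>
  show ?case
    by (intro exI[of _ "\<lambda>p x v. if v = replicate (length fs) False then x 0 else 0"])
      (auto simp: linear_op_def)
next
  case (Suc n)
  let ?m = "length fs"
  obtain \<Psi> where lin: "\<And>p. linear_op (\<Psi> p)"
    and \<Psi>0: "\<And>x. \<Psi> 0 x = (\<lambda>v. if v = replicate ?m False then x 0 else 0)"
    and chains: "\<And>p x. p < n \<Longrightarrow> \<Psi> p x \<in> koszul_chains ?m p"
    and comm: "\<And>p x. Suc p < n \<Longrightarrow> x \<in> supported (rank (Suc p)) \<Longrightarrow>
      koszul_bd fs (\<Psi> (Suc p) x) = \<Psi> p (mat_op (\<phi> (Suc p)) x)"
    using Suc by fastforce
  show ?case
  proof (cases n)
    case 0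
    then show ?thesis
      using lin \<Psi>0 by (intro exI[of _ \<Psi>]) (auto simp: koszul_chains_def)
  next
    case (Suc q)
    have q: "q \<le> r" "q < n" using Suc.prems Suc by auto
    define a where "a l = \<Psi> q (mat_op (\<phi> (Suc q)) (unit_fun l))" for l
    have "koszul_cycle fs q (a l)" for l
    proof -
      have cyc: "res_cycle J \<phi> q (mat_op (\<phi> (Suc q)) (unit_fun l))"
        by (rule image_is_cycle[OF q(1)])
      show ?thesis
      proof (cases q)
        case 0
        then show ?thesis
          using cyc chains[OF q(2)] assms(2) by (auto simp: koszul_cycle_def a_def \<Psi>0 res_cycle_def)
      next
        case (Suc q')
        have "mat_op (\<phi> (Suc q)) (unit_fun l) \<in> supported (rank q)"
          using mat_op_supported[of "\<phi> (Suc q)"] phi_carrier[OF q(1)] by auto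
        then have "koszul_bd fs (a l) = \<Psi> q' (\<lambda>_. 0)"
          using comm[of q'] q Suc cyc by (simp add: a_def res_cycle_def)
        then show ?thesis
          using chains[OF q(2)] Suc by (simp add: koszul_cycle_def a_def linear_op_zero[OF lin])
      qed
    qed
    then have "\<exists>b\<in>koszul_chains ?m (Suc q). koszul_bd fs b = a l" for l
      using koszul_exact[OF assms(1)] by blast
    then obtain b where b: "\<And>l. b l \<in> koszul_chains ?m (Suc q)" "\<And>l. koszul_bd fs (b l) = a l"
      by metis
    define \<Psi>' where "\<Psi>' = \<Psi>(n := \<lambda>x v. \<Sum>l<rank n. x l * b l v)"
    have same: "\<Psi>' p = \<Psi> p" if "p \<noteq> n" for p using that by (simp add: \<Psi>'_def)
    have new: "\<Psi>' n x = (\<lambda>v. \<Sum>l<rank n. x l * b l v)" for x by (simp add: \<Psi>'_def)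
    have "linear_op (\<Psi>' n)"
      by (auto simp: linear_op_def new fun_eq_iff sum.distrib sum_distrib_left algebra_simps)
    then have "linear_op (\<Psi>' p)" for p using lin same by (cases "p = n") auto
    moreover have "\<Psi>' 0 x = (\<lambda>v. if v = replicate ?m False then x 0 else 0)" for x
      using same[of 0] \<Psi>0 Suc by simp
    moreover have "\<Psi>' p x \<in> koszul_chains ?m p" if "p < Suc n" for p x
      using that chains[of p x] same[of p] koszul_chains_sum[of "{..<rank n}" b ?m n x] b(1) Suc
      by (cases "p = n") (simp_all add: new[unfolded Suc])
    moreover have "koszul_bd fs (\<Psi>' (Suc p) x) = \<Psi>' p (mat_op (\<phi> (Suc p)) x)"
      if "Suc p < Suc n" "x \<in> supported (rank (Suc p))" for p x
    proof (cases "Suc p = n")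
      case False
      then show ?thesis using comm[of p x] that same[of p] same[of "Suc p"] by simp
    next
      case True
      then have pq: "p = q" using Suc by simp
      have x: "x = (\<lambda>i. \<Sum>l<rank n. x l * unit_fun l i)"
        using supported_expand that(2) True by simp
      have "koszul_bd fs (\<Psi>' n x) = (\<lambda>v. \<Sum>l<rank n. x l * a l v)"
        unfolding new linear_op_sum[OF linear_op_koszul_bd] b(2) ..
      also have "\<dots> = \<Psi> q (\<lambda>j. \<Sum>l<rank n. x l * mat_op (\<phi> n) (unit_fun l) j)"
        unfolding linear_op_sum[OF lin] by (simp add: a_def Suc)
      also have "(\<lambda>j. \<Sum>l<rank n. x l * mat_op (\<phi> n) (unit_fun l) j) = mat_op (\<phi> n) x"
        by (subst (2) x) (simp add: linear_op_sum[OF linear_op_mat_op])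
      finally show ?thesis using True pq same[of q] q(2) by simp
    qed
    ultimately show ?thesis by blast
  qed
qed

end

text \<open>The internal degree of the Koszul basis vector encoded by the word.\<close>

fun word_degree :: "int list \<Rightarrow> bool list \<Rightarrow> int" where
  "word_degree (d # ds) (b # w) = (if b then d else 0) + word_degree ds w"
| "word_degree _ _ = 0"

lemma koszul_comb_graded:
  assumes "list_all2 (\<lambda>f d. f \<in> graded_part d) fs ds" "length w = length fs"
    "\<And>v. length v = length fs \<Longrightarrow> u v \<in> graded_part (c + word_degree ds v)"
  shows "koszul_comb fs u w \<in> graded_part (c + word_degree ds w)"
  using assms
proof (induction fs arbitrary: ds w u c)
  case (Cons f fs)
  obtain d ds' where ds: "ds = d # ds'" "f \<in> graded_part d" "list_all2 (\<lambda>f d. f \<in> graded_part d) fs ds'"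
    using Cons.prems(1) by (auto simp: list_all2_Cons1)
  obtain b w' where w: "w = b # w'" "length w' = length fs" using Cons.prems(2) by (cases w) auto
  have F: "u (False # v) \<in> graded_part (c + word_degree ds' v)"
    and T: "u (True # v) \<in> graded_part ((c + d) + word_degree ds' v)" if "length v = length fs" for v
    using Cons.prems(3)[of "False # v"] Cons.prems(3)[of "True # v"] that by (auto simp: ds(1) algebra_simps)
  show ?case
  proof (cases b)
    case False
    then show ?thesis using Cons.IH[OF ds(3) w(2) F] by (simp add: w(1) ds(1))
  next
    case True
    have "f * u (False # w') \<in> graded_part (d + (c + word_degree ds' w'))"
      by (rule graded_part_mult[OF ds(2) F[OF w(2)]])
    moreover have "koszul_comb fs (\<lambda>v. u (True # v)) w' \<in> graded_part ((c + d) + word_degree ds' w')"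
      by (rule Cons.IH[OF ds(3) w(2) T])
    ultimately show ?thesis
      using True by (auto simp: w(1) ds(1) algebra_simps intro: graded_part_diff)
  qed
qed simp

context graded_resolution
begin

text \<open>The comparison theorem in the other direction, with the Koszul complex as the free side
  and the resolution as the exact one. It starts with multiplication by \<open>g\<close>, which is
  well defined on the quotients by \<open>gJ\<close>; \<open>exact_graded\<close> keeps track of
  degrees.\<close>

lemma chain_map_from_koszul:
  assumes deg: "list_all2 (\<lambda>f d. f \<in> graded_part d) fs ds" and len: "length fs = r"
    and g: "g \<in> graded_part c" and gJ: "\<And>x. x \<in> ideal_gen (set fs) \<Longrightarrow> g * x \<in> J"
  shows "\<exists>u. \<forall>w. length w = r \<longrightarrow>
    u w \<in> supported (rank (weight w)) \<and> homog_vec (D (weight w)) (c + word_degree ds w) (u w) \<and>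
    (if weight w = 0 then u w = (\<lambda>l. if l = 0 then g else 0)
     else mat_op (\<phi> (weight w)) (u w) = (\<lambda>i. koszul_comb fs (\<lambda>v. u v i) w))"
proof (rule koszul_comb_family_exists[of r "\<lambda>w y k. y \<in> supported (rank (weight w)) \<and>
    homog_vec (D (weight w)) (c + word_degree ds w) y \<and>
    (if weight w = 0 then y = (\<lambda>l. if l = 0 then g else 0) else mat_op (\<phi> (weight w)) y = k)"])
  fix w :: "bool list" and h :: "bool list \<Rightarrow> nat \<Rightarrow> ('x, 'k) mpoly"
  assume w: "length w = r"
    and h: "\<And>v. length v = r \<Longrightarrow> Suc (weight v) = weight w \<Longrightarrow>
      h v \<in> supported (rank (weight v)) \<and> homog_vec (D (weight v)) (c + word_degree ds v) (h v) \<and>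
      (if weight v = 0 then h v = (\<lambda>l. if l = 0 then g else 0)
       else mat_op (\<phi> (weight v)) (h v) = (\<lambda>i. koszul_comb fs (\<lambda>w. h w i) v))"
  let ?N = "c + word_degree ds w"
  let ?k = "\<lambda>i. koszul_comb fs (\<lambda>w. h w i) w"
  show "\<exists>y. y \<in> supported (rank (weight w)) \<and> homog_vec (D (weight w)) ?N y \<and>
    (if weight w = 0 then y = (\<lambda>l. if l = 0 then g else 0) else mat_op (\<phi> (weight w)) y = ?k)"
  proof (cases "weight w")
    case 0
    have "word_degree ds w = 0"
      using 0
    proof (induction ds w rule: word_degree.induct)
      case (1 d ds b w)
      then show ?case by (cases b) auto
    qed auto
    then show ?thesis
      using 0 g by (intro exI[of _ "\<lambda>l. if l = 0 then g else 0"]) (auto simp: supported_def homog_vec_def D_0)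
  next
    case (Suc p)
    have p: "p \<le> r" using weight_le_length[of w] w Suc by simp
    have hv: "h v \<in> supported (rank p)" "homog_vec (D p) (c + word_degree ds v) (h v)"
      "if p = 0 then h v = (\<lambda>l. if l = 0 then g else 0) else mat_op (\<phi> p) (h v) = (\<lambda>i. koszul_comb fs (\<lambda>w. h w i) v)"
      if "length v = r" "weight v = p" for v
      using h[of v] that Suc by auto
    have "?k \<in> supported (rank p)"
      unfolding supported_def
    proof safe
      fix l assume "rank p \<le> l"
      then have "?k l = koszul_comb fs (\<lambda>_. 0) w"
        using hv(1) w Suc by (intro koszul_comb_cong) (auto simp: supported_def)
      then show "?k l = 0" by simp
    qed
    moreover have "homog_vec (D p) ?N ?k"
      unfolding homog_vec_def
    proof safe
      fix l assume l: "l < rank p"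
      \<comment> \<open>\<open>koszul_comb_graded\<close> asks for a degree at every word, whereas
        it is known here only for weight \<open>p\<close>; zero is homogeneous of every
        degree.\<close>
      let ?u = "\<lambda>v. if weight v = p then h v l else 0"
      have "koszul_comb fs ?u w \<in> graded_part ((c - D p ! l) + word_degree ds w)"
        using hv(2) l len w by (intro koszul_comb_graded[OF deg]) (auto simp: homog_vec_def algebra_simps)
      moreover have "koszul_comb fs ?u w = ?k l"
        using Suc by (intro koszul_comb_cong) auto
      ultimately show "?k l \<in> graded_part (?N - D p ! l)" by (simp add: algebra_simps)
    qed
    moreover have "res_cycle J \<phi> p ?k"
    proof (cases p)
      case 0
      have "?k 0 = koszul_comb fs (\<lambda>v. g * 1) w"
        using hv(3) 0 w Suc by (intro koszul_comb_cong) auto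
      also have "\<dots> = g * koszul_comb fs (\<lambda>_. 1) w" by (rule koszul_comb_scale)
      finally show ?thesis using gJ[OF koszul_comb_mem] 0 by (simp add: res_cycle_def)
    next
      case (Suc q)
      have "mat_op (\<phi> p) ?k = (\<lambda>j. koszul_comb fs (\<lambda>v. mat_op (\<phi> p) (h v) j) w)"
        by (rule linear_op_koszul_comb[OF linear_op_mat_op])
      also have "\<dots> = (\<lambda>j. koszul_comb fs (koszul_comb fs (\<lambda>v. h v j)) w)"
        using hv(3) w Suc \<open>weight w = Suc p\<close> by (intro ext koszul_comb_cong) auto
      also have "\<dots> = (\<lambda>_. 0)" by (simp add: koszul_comb_koszul_comb)
      finally show ?thesis using Suc by (simp add: res_cycle_def)
    qed
    ultimately show ?thesis using exact_graded[OF p, of ?k ?N] Suc by auto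
  qed
qed

text \<open>
  The composite of the chain maps Koszul(\<open>f, fs\<close>) \<open>\<rightarrow>\<close> resolution \<open>\<rightarrow>\<close> Koszul(\<open>g f, fs\<close>) lifts
  multiplication by \<open>g\<close>, as does the map given by \<open>twisted_basis g\<close>. The two are homotopic, hence
  equal modulo the irrelevant ideal, and the latter has diagonal entry \<open>1\<close> at every word starting
  with \<open>True\<close>. Therefore the first map sends the corresponding basis vector to a vector having a unit
  among its coordinates, which reveals the degree of a generator of the resolution.
\<close>

lemma shift_mem:
  assumes deg: "list_all2 (\<lambda>f d. f \<in> graded_part d) (f # fs) ds" and pos: "\<forall>d\<in>set ds. d > 0"
    and len: "length (f # fs) = r"
    and g: "g \<in> graded_part c" and gJ: "\<And>x. x \<in> ideal_gen (set (f # fs)) \<Longrightarrow> g * x \<in> J"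
    and reg: "koszul_regular (g * f # fs)" and J: "J \<subseteq> ideal_gen (set (g * f # fs))"
    and w: "length w = r" "hd w"
  shows "c + word_degree ds w \<in> set (D (weight w))"
proof -
  let ?fs = "f # fs" and ?gs = "g * f # fs"
  have len': "length ?gs = r" using len by simp
  obtain u where u: "\<And>w. length w = r \<Longrightarrow> u w \<in> supported (rank (weight w))"
      "\<And>w. length w = r \<Longrightarrow> homog_vec (D (weight w)) (c + word_degree ds w) (u w)"
      "\<And>w. length w = r \<Longrightarrow> if weight w = 0 then u w = (\<lambda>l. if l = 0 then g else 0)
       else mat_op (\<phi> (weight w)) (u w) = (\<lambda>i. koszul_comb ?fs (\<lambda>v. u v i) w)"
    using chain_map_from_koszul[OF deg len g gJ] by blast
  obtain \<Psi> where lin: "\<And>p. linear_op (\<Psi> p)"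
    and \<Psi>0: "\<And>x. \<Psi> 0 x = (\<lambda>v. if v = replicate r False then x 0 else 0)"
    and chains: "\<And>p x. p \<le> r \<Longrightarrow> \<Psi> p x \<in> koszul_chains r p"
    and comm: "\<And>p x. Suc p \<le> r \<Longrightarrow> x \<in> supported (rank (Suc p)) \<Longrightarrow>
      koszul_bd ?gs (\<Psi> (Suc p) x) = \<Psi> p (mat_op (\<phi> (Suc p)) x)"
    using chain_map_to_koszul[OF reg J order_refl, unfolded len' less_Suc_eq_le] by blast
  define c' where "c' w = \<Psi> (weight w) (u w)" for w
  define T where "T w v = c' w v - twisted_basis g w v" for w v
  have weight_le: "weight w \<le> r" if "length w = r" for w using weight_le_length[of w] that by simp
  have T_chains: "T w \<in> koszul_chains r (weight w)" if "length w = r" for w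
  proof -
    have "twisted_basis g w \<in> koszul_chains r (weight w)"
      using that by (auto simp: twisted_basis_def koszul_chains_def)
    from koszul_chains_diff[OF chains[OF weight_le[OF that]] this] show ?thesis
      by (simp add: T_def[abs_def] c'_def)
  qed
  have T_0: "T w v = 0" if "length w = r" "weight w = 0" for w v
  proof -
    have "w = replicate r False" using that weight_eq_0_iff by metis
    moreover have "hd (replicate r False) = False" using len by auto
    ultimately show ?thesis using u(3)[OF that(1)] that(2)
      by (auto simp: T_def c'_def twisted_basis_def \<Psi>0)
  qed
  have T_bd: "koszul_bd ?gs (T w) v = koszul_comb ?fs (\<lambda>w. T w v) w" if w: "length w = r" for w v
  proof (cases "weight w")
    case 0
    have "T w = (\<lambda>_. 0)" using T_0[OF w 0] by auto
    then show ?thesis using koszul_comb_weight_0[OF 0] by simp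
  next
    case (Suc p)
    have p: "Suc p \<le> r" using weight_le[OF w] Suc by simp
    have "koszul_bd ?gs (c' w) = \<Psi> p (\<lambda>i. koszul_comb ?fs (\<lambda>v. u v i) w)"
      using comm[OF p, of "u w"] u(1,3)[OF w] Suc by (simp add: c'_def)
    also have "\<dots> = (\<lambda>v. koszul_comb ?fs (\<lambda>w. \<Psi> p (u w) v) w)"
      by (rule linear_op_koszul_comb[OF lin])
    also have "\<dots> = (\<lambda>v. koszul_comb ?fs (\<lambda>w. c' w v) w)"
      using Suc by (intro ext koszul_comb_cong) (simp add: c'_def)
    finally have 1: "koszul_bd ?gs (c' w) v = koszul_comb ?fs (\<lambda>w. c' w v) w" by simp
    have 2: "koszul_bd ?gs (twisted_basis g w) v = koszul_comb ?fs (\<lambda>w. twisted_basis g w v) w"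
    proof (cases "length v = r")
      case True
      then show ?thesis using w len by (intro koszul_bd_twisted_basis) auto
    next
      case False
      have "koszul_comb ?fs (\<lambda>w. twisted_basis g w v) w = koszul_comb ?fs (\<lambda>_. 0) w"
        using w False by (intro koszul_comb_cong) (auto simp: twisted_basis_def)
      moreover have "twisted_basis g w \<in> koszul_chains (length ?gs) (Suc p)"
        using w Suc len by (auto simp: twisted_basis_def koszul_chains_def)
      then have "koszul_bd ?gs (twisted_basis g w) \<in> koszul_chains (length ?gs) p"
        by (rule koszul_bd_chains)
      then have "koszul_bd ?gs (twisted_basis g w) v = 0"
        using koszul_chainsD[of _ "length ?gs" p v] False len by auto
      ultimately show ?thesis by simp
    qed
    show ?thesis unfolding T_def[abs_def] koszul_bd_diff koszul_comb_diff 1 2 ..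
  qed
  \<comment> \<open>The null homotopy \<open>d h + h d = T\<close>, solved for \<open>d h\<close>
    and built by increasing weight.\<close>
  have "\<exists>h. \<forall>w. length w = r \<longrightarrow> h w \<in> koszul_chains r (Suc (weight w)) \<and>
    koszul_bd ?gs (h w) = (\<lambda>v. T w v - koszul_comb ?fs (\<lambda>w. h w v) w)"
  proof (rule koszul_comb_family_exists[of r "\<lambda>w y k. y \<in> koszul_chains r (Suc (weight w)) \<and>
      koszul_bd ?gs y = (\<lambda>v. T w v - k v)"])
    fix w :: "bool list" and h :: "bool list \<Rightarrow> bool list \<Rightarrow> ('x, 'k) mpoly"
    assume w: "length w = r"
      and h: "\<And>v. length v = r \<Longrightarrow> Suc (weight v) = weight w \<Longrightarrow>
        h v \<in> koszul_chains r (Suc (weight v)) \<and>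
        koszul_bd ?gs (h v) = (\<lambda>i. T v i - koszul_comb ?fs (\<lambda>w. h w i) v)"
    let ?k = "\<lambda>i. koszul_comb ?fs (\<lambda>w. h w i) w"
    show "\<exists>y. y \<in> koszul_chains r (Suc (weight w)) \<and> koszul_bd ?gs y = (\<lambda>v. T w v - ?k v)"
    proof (cases "weight w")
      case 0
      then show ?thesis
        using T_0[OF w 0]
        by (intro exI[of _ "\<lambda>_. 0"]) (simp add: koszul_chains_zero koszul_comb_weight_0 fun_eq_iff)
    next
      case (Suc p)
      have "?k \<in> koszul_chains r (weight w)"
        unfolding koszul_chains_def
      proof (intro CollectI allI impI)
        fix i assume nz: "?k i \<noteq> 0"
        show "length i = r \<and> weight i = weight w"
        proof (rule ccontr)
          assume *: "\<not> (length i = r \<and> weight i = weight w)"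
          have "h v i = 0" if "length v = length w" "Suc (weight v) = weight w" for v
          proof (rule ccontr)
            assume "h v i \<noteq> 0"
            then show False using koszul_chainsD[of "h v" r "Suc (weight v)" i] h[of v] that w * by simp
          qed
          then have "?k i = koszul_comb ?fs (\<lambda>_. 0) w" by (intro koszul_comb_cong)
          then show False using nz by simp
        qed
      qed
      then have "(\<lambda>v. T w v - ?k v) \<in> koszul_chains r (weight w)"
        by (rule koszul_chains_diff[OF T_chains[OF w]])
      \<comment> \<open>Inserting the homotopy equation on the boundary of \<open>w\<close> leaves
        the combination of the \<open>T\<close>, since the nested term dies by
        \<open>d d = 0\<close>; by \<open>T_bd\<close> this is the boundary of
        \<open>T w\<close>.\<close>
      moreover have "koszul_bd ?gs (\<lambda>v. T w v - ?k v) v = 0" for v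
      proof -
        have "koszul_bd ?gs ?k v = koszul_comb ?fs (\<lambda>w. koszul_bd ?gs (h w) v) w"
          using linear_op_koszul_comb[OF linear_op_koszul_bd] by (rule fun_cong)
        also have "\<dots> = koszul_comb ?fs (\<lambda>w. T w v - koszul_comb ?fs (\<lambda>w. h w v) w) w"
          using h w by (intro koszul_comb_cong) auto
        also have "\<dots> = koszul_comb ?fs (\<lambda>w. T w v) w"
          by (simp only: koszul_comb_diff koszul_comb_koszul_comb diff_zero)
        finally show ?thesis by (simp only: koszul_bd_diff T_bd[OF w] diff_self)
      qed
      ultimately have "koszul_cycle ?gs (weight w) (\<lambda>v. T w v - ?k v)"
        using Suc len by (simp add: koszul_cycle_def)
      from koszul_exact[OF reg this] show ?thesis using len by auto
    qed
  qed
  then obtain h where h: "koszul_bd ?gs (h w) = (\<lambda>v. T w v - koszul_comb ?fs (\<lambda>w. h w v) w)"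
    using w(1) by blast
  have T_eq: "T w w = koszul_bd ?gs (h w) w + koszul_comb ?fs (\<lambda>v. h v w) w"
    by (simp add: h)
  have fs_0: "Poly_Mapping.lookup x 0 = 0" if x: "x \<in> set ?fs" for x
  proof -
    obtain i where i: "i < length ?fs" "x = ?fs ! i" using x by (metis in_set_conv_nth)
    then have "x \<in> graded_part (ds ! i)" "ds ! i > 0"
      using deg pos by (auto simp: list_all2_conv_all_nth)
    then show ?thesis using graded_part_lookup_zero by fastforce
  qed
  have gs_0: "Poly_Mapping.lookup x 0 = 0" if "x \<in> set ?gs" for x
    using that fs_0 by (auto simp: lookup_mult_zero)
  \<comment> \<open>Both homotopy terms lie in ideals generated by elements without constant
    term.\<close>
  have "Poly_Mapping.lookup (T w w) 0 = 0"
    unfolding T_eq lookup_add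
    by (simp only: ideal_gen_lookup_zero[OF gs_0 koszul_bd_mem]
        ideal_gen_lookup_zero[OF fs_0 koszul_comb_mem] add_0)
  then have "Poly_Mapping.lookup (c' w w) 0 = 1"
    using w(2) by (simp add: T_def twisted_basis_def lookup_minus)
  moreover have "c' w = \<Psi> (weight w) (\<lambda>i. \<Sum>l<rank (weight w). u w l * unit_fun l i)"
    unfolding c'_def by (rule arg_cong[OF supported_expand[OF u(1)[OF w(1)]]])
  then have "c' w w = (\<Sum>l<rank (weight w). u w l * \<Psi> (weight w) (unit_fun l) w)"
    by (simp only: linear_op_sum[OF lin])
  ultimately have "(\<Sum>l<rank (weight w). Poly_Mapping.lookup (u w l) 0 *
      Poly_Mapping.lookup (\<Psi> (weight w) (unit_fun l) w) 0) \<noteq> 0"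
    by (simp add: lookup_sum lookup_mult_zero)
  then obtain l where l: "l < rank (weight w)" "Poly_Mapping.lookup (u w l) 0 \<noteq> 0"
    by (metis (no_types, lifting) lessThan_iff mult_zero_left sum.neutral)
  have "u w l \<in> graded_part (c + word_degree ds w - D (weight w) ! l)"
    using u(2)[OF w(1)] l(1) by (simp add: homog_vec_def)
  \<comment> \<open>A homogeneous coordinate with nonzero constant term has degree 0.\<close>
  then have "c + word_degree ds w = D (weight w) ! l"
    using graded_part_lookup_zero l(2) by fastforce
  then show ?thesis using l(1) by simp
qed

text \<open>No column of a minimal resolution is zero: otherwise a unit vector would be a cycle,
  hence an image under the next map, whose entries have no constant term. A nonzero entry in the
  irrelevant ideal has positive degree, so each shift exceeds one of the preceding step.\<close>

lemma minimal_shifts_nonneg: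
  assumes min: "\<forall>i\<in>{1..r}. \<forall>j<length (D (i - 1)). \<forall>l<length (D i). \<phi> i $$ (j, l) \<in> irrelevant_ideal"
    and "p \<le> r" "d \<in> set (D p)"
  shows "d \<ge> 0"
  using assms(2,3)
proof (induction p arbitrary: d)
  case 0
  then show ?case by (simp add: D_0)
next
  case (Suc p)
  then obtain l where l: "l < rank (Suc p)" "d = D (Suc p) ! l" by (metis in_set_conv_nth)
  let ?x = "mat_op (\<phi> (Suc p)) (unit_fun l)"
  have phi: "\<phi> (Suc p) \<in> carrier_mat (rank p) (rank (Suc p))" using phi_carrier Suc.prems(1) by simp
  have "?x \<noteq> (\<lambda>_. 0)"
  proof
    assume "?x = (\<lambda>_. 0)"
    then obtain y where y: "mat_op (\<phi> (Suc (Suc p))) y = unit_fun l"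
      using exact[OF Suc.prems(1) supported_unit_fun[OF l(1)]] by (auto simp: res_cycle_def)
    have "Poly_Mapping.lookup (mat_op (\<phi> (Suc (Suc p))) y l) 0 = 0"
    proof (cases "Suc p < r")
      case True
      have "Poly_Mapping.lookup (\<phi> (Suc (Suc p)) $$ (l, k)) 0 = 0" if "k < rank (Suc (Suc p))" for k
        using min True l(1) that by (intro irrelevant_ideal_lookup_zero) (auto dest: bspec[of _ _ "Suc (Suc p)"])
      then show ?thesis
        using phi_carrier[OF Suc.prems(1)] by (auto simp: mat_op_def lookup_sum lookup_mult_zero)
    next
      case False
      then have "Suc p = r" using Suc.prems(1) by simp
      then show ?thesis using phi_carrier[of r] by (auto simp: mat_op_def D_Suc_r)
    qed
    then show False unfolding y by (simp add: unit_fun_def)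
  qed
  then obtain j where "?x j \<noteq> 0" by auto
  moreover from this have "j < rank p"
    using phi by (auto simp: mat_op_def split: if_splits)
  ultimately have j: "j < rank p" "\<phi> (Suc p) $$ (j, l) \<noteq> 0"
    using phi l(1) mat_op_unit_fun[of j "\<phi> (Suc p)" l] by auto
  have "\<phi> (Suc p) $$ (j, l) \<in> irrelevant_ideal"
    using min Suc.prems(1) j(1) l(1) by (auto dest: bspec[of _ _ "Suc p"])
  then have "D (Suc p) ! l - D p ! j > 0"
    using phi_graded[of p] Suc.prems(1) j l(1) by (intro graded_part_pos[of "\<phi> (Suc p) $$ (j, l)"])
      (auto intro: irrelevant_ideal_lookup_zero)
  moreover have "D p ! j \<ge> 0" using Suc.IH[of "D p ! j"] Suc.prems(1) j(1) by simp
  ultimately show ?case using l(2) by simp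
qed

end

section \<open>The multiplicity bounds\<close>

lemma prod_gens_power_mem:
  "t \<in> T \<Longrightarrow> x \<in> ideal_gen T \<Longrightarrow> t ^ n * x \<in> ideal_gen (prod_gens T (Suc n))"
proof (induction n)
  case (Suc n)
  show ?case
    using prod_gens_mult_mem[OF Suc.prems(1) Suc.IH[OF Suc.prems]] by (simp only: power_Suc mult.assoc)
qed simp

text \<open>A product of \<open>s\<close> factors either contains a member of \<open>T\<close> or is
  \<open>f ^ s\<close>.\<close>

lemma prod_gens_subset_power:
  "prod_gens (insert f T) s \<subseteq> ideal_gen (insert (f ^ s) T)"
proof (induction s)
  case 0
  then show ?case by (auto intro: ideal.span_base)
next
  case (Suc s)
  show ?case
  proof
    fix x assume "x \<in> prod_gens (insert f T) (Suc s)"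
    then obtain a y where ay: "x = a * y" "a = f \<or> a \<in> T" "y \<in> ideal_gen (insert (f ^ s) T)"
      using Suc by auto
    from ay(2) show "x \<in> ideal_gen (insert (f ^ Suc s) T)"
    proof
      assume "a = f"
      obtain h where "y - f ^ s * h \<in> ideal_gen T" using ay(3) by (auto simp: ideal_gen_insert_iff)
      then have "f * (y - f ^ s * h) \<in> ideal_gen T" by (rule ideal_gen_mult)
      then have "x - f ^ Suc s * h \<in> ideal_gen T"
        unfolding ay(1) \<open>a = f\<close> by (simp add: algebra_simps)
      then show ?thesis unfolding ideal_gen_insert_iff by blast
    next
      assume "a \<in> T"
      then show ?thesis unfolding ay(1) by (intro ideal_gen_mult_right ideal.span_base) auto
    qed
  qed
qed

lemma word_degree_initial:
  "i \<le> length es \<Longrightarrow>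
    word_degree es (replicate i True @ replicate (length es - i) False) = sum_list (take i es)"
proof (induction es arbitrary: i)
  case Nil
  then show ?case by simp
next
  case (Cons e es)
  show ?case
  proof (cases i)
    case 0
    then show ?thesis using Cons.IH[of 0] by simp
  next
    case (Suc j)
    then show ?thesis using Cons by simp
  qed
qed

text \<open>\<open>shift_mem\<close> is applied with \<open>g = f ^ (s - 1)\<close>, for which
  \<open>g * f = f ^ s\<close>. The word starting with \<open>i\<close> entries \<open>True\<close>
  stands for the exterior product of the first \<open>i\<close> basis vectors.\<close>

lemma initial_shift_mem:
  fixes fs :: "('x::finite, 'k::comm_ring_1) mpoly list"
  assumes res: "graded_free_resolution (ideal_gen (prod_gens (set fs) s)) (length fs) D \<phi>"
    and perm: "perm_reg_seq {} fs" and s: "s > 0"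
    and deg: "list_all2 (\<lambda>f d. f \<in> graded_part (int d)) fs es" and pos: "\<forall>e\<in>set es. e > 0"
    and i: "1 \<le> i" "i \<le> length fs"
  shows "int ((s - 1) * es ! 0 + sum_list (take i es)) \<in> set (D i)"
proof -
  interpret graded_resolution "ideal_gen (prod_gens (set fs) s)" "length fs" D \<phi>
    by unfold_locales (rule res)
  obtain f fs' where fs: "fs = f # fs'" using i by (cases fs) auto
  obtain e es' where es: "es = e # es'" using deg fs by (auto simp: list_all2_Cons1)
  have len: "length es = length fs" using deg by (simp add: list_all2_lengthD)
  have f_power: "f ^ (s - 1) * f = f ^ s" using s by (metis power_minus_mult)
  let ?w = "replicate i True @ replicate (length (map int es) - i) False"
  have "int (s - 1) * int e + word_degree (map int es) ?w \<in> set (D (weight ?w))"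
  proof (rule shift_mem[of f fs' "map int es" "f ^ (s - 1)" "int (s - 1) * int e" ?w])
    show "list_all2 (\<lambda>f d. f \<in> graded_part d) (f # fs') (map int es)"
      using deg fs by (simp add: list_all2_map2)
    show "f ^ (s - 1) \<in> graded_part (int (s - 1) * int e)"
      using deg by (intro graded_part_power) (simp add: fs es)
    show "f ^ (s - 1) * x \<in> ideal_gen (prod_gens (set fs) s)" if "x \<in> ideal_gen (set (f # fs'))" for x
      using prod_gens_power_mem[of f "set fs" x "s - 1"] that s fs by simp
    have p: "perm_reg_seq {} (f # fs')" using perm fs by simp
    show "koszul_regular (f ^ (s - 1) * f # fs')"
      unfolding f_power
      using nzd_power[OF perm_reg_seq_nzd_last[OF p]]
        koszul_regular_if_perm_reg_seq[OF perm_reg_seq_tl[OF p]] by simp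
    show "ideal_gen (prod_gens (set fs) s) \<subseteq> ideal_gen (set (f ^ (s - 1) * f # fs'))"
      unfolding f_power using prod_gens_subset_power[of f "set fs'" s] fs
      by (intro ideal_gen_subsetI) simp
    show "hd ?w" using i by (cases i) auto
  qed (use pos fs len i in auto)
  moreover have "weight ?w = i"
    by (simp add: weight_def)
  moreover have "sum_list (map int xs) = int (sum_list xs)" for xs
    by (induction xs) auto
  then have "word_degree (map int es) ?w = int (sum_list (take i es))"
    using word_degree_initial[of i "map int es"] i len by (simp add: take_map)
  ultimately show ?thesis by (simp add: es)
qed

section \<open>Numerical estimates and the final comparison\<close>

lemma sum_list_take_le_sorted:
  assumes "sorted es" "1 \<le> i" "i \<le> length es"
  shows "(m::nat) * es ! 0 + sum_list (take i es) \<le> (m + i) * es ! (i - 1)"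
proof -
  have "sum_list (take i es) = (\<Sum>k<i. es ! k)"
    using assms by (simp add: sum_list_sum_nth atLeast0LessThan)
  also have "\<dots> \<le> (\<Sum>k<i. es ! (i - 1))"
    using assms by (intro sum_mono sorted_nth_mono) auto
  finally have "sum_list (take i es) \<le> i * es ! (i - 1)" by simp
  moreover have "m * es ! 0 \<le> m * es ! (i - 1)"
    using assms by (intro mult_left_mono sorted_nth_mono) auto
  ultimately show ?thesis unfolding add_mult_distrib by linarith
qed

lemma sum_list_take_ge_sorted:
  assumes "sorted_wrt (\<ge>) es" "1 \<le> i" "i \<le> length es"
  shows "(m::nat) * es ! 0 + sum_list (take i es) \<ge> (m + i) * es ! (i - 1)"
proof -
  have mono: "es ! k \<ge> es ! (i - 1)" if "k < i" for k
    using sorted_wrt_nth_less[OF assms(1), of k "i - 1"] that assms(3) by (cases "k = i - 1") auto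
  have "(\<Sum>k<i. es ! (i - 1)) \<le> (\<Sum>k<i. es ! k)"
    using mono by (intro sum_mono) auto
  also have "\<dots> = sum_list (take i es)"
    using assms by (simp add: sum_list_sum_nth atLeast0LessThan)
  finally have "i * es ! (i - 1) \<le> sum_list (take i es)" by simp
  moreover have "m * es ! (i - 1) \<le> m * es ! 0"
    using mono[of 0] assms by (intro mult_left_mono) auto
  ultimately show ?thesis unfolding add_mult_distrib by linarith
qed

lemma prod_rising_factors:
  assumes "s > 0"
  shows "(\<Prod>i=1..r. s - 1 + i) = fact r * ((s + r - 1) choose r)"
proof -
  obtain m where m: "s = Suc m" using assms by (cases s) auto
  show ?thesis unfolding m
  proof (induction r)
    case (Suc r)
    have "(\<Prod>i=1..Suc r. Suc m - 1 + i) = fact r * (Suc (m + r) * ((m + r) choose r))"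
      using Suc by (simp add: algebra_simps)
    also have "\<dots> = fact r * (Suc r * (Suc (m + r) choose Suc r))"
      by (simp only: Suc_times_binomial)
    finally show ?case by (simp add: algebra_simps)
  qed simp
qed

lemma prod_rising_factors_list:
  fixes es :: "nat list"
  assumes "s > 0" "length es = r"
  shows "(\<Prod>i=1..r. (s - 1 + i) * es ! (i - 1)) = fact r * (((s + r - 1) choose r) * prod_list es)"
proof -
  have "(\<Prod>i=1..r. es ! (i - 1)) = (\<Prod>i<r. es ! i)"
    by (rule prod.reindex_bij_witness[of _ Suc "\<lambda>i. i - 1"]) auto
  also have "\<dots> = prod_list es" using assms(2) by (simp add: prod.list_conv_set_nth atLeast0LessThan)
  finally show ?thesis unfolding prod.distrib prod_rising_factors[OF assms(1)] by simp
qed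

lemma complete_intersectionE:
  fixes I :: "('x::finite, 'k::field) mpoly set"
  assumes "complete_intersection I ds"
  obtains Fs where "I = ideal_gen (set Fs)" "ideal_gen (set Fs) \<noteq> UNIV" "perm_reg_seq {} Fs"
    "list_all2 (\<lambda>f d. f \<in> graded_part (int d)) Fs ds" "\<forall>d\<in>set ds. d > 0"
proof -
  obtain Fs where len: "length Fs = length ds" and deg: "\<And>i. i < length ds \<Longrightarrow> Fs ! i \<in> graded_part (int (ds ! i))"
    and reg: "regular_sequence Fs" and I: "I = ideal_gen (set Fs)"
    using assms unfolding complete_intersection_def by blast
  have proper: "ideal_gen (set Fs) \<noteq> UNIV" using reg by (simp add: regular_sequence_def)
  have nzd: "nzd (set (take i Fs)) (Fs ! i)" if "i < length Fs" for i
    using reg that by (simp add: regular_sequence_def nzd_def)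
  then have rs: "reg_seq {} Fs" by (simp add: reg_seq_iff_nth)
  \<comment> \<open>A form of degree 0 is a constant. If it is 0, regularity puts 1 into the ideal
    of its predecessors; otherwise it is a unit. Either way the ideal would not be proper.\<close>
  have pos: "ds ! i > 0" if i: "i < length ds" for i
  proof (rule ccontr)
    assume "\<not> ds ! i > 0"
    then have F: "Fs ! i \<in> graded_part 0" using deg[OF i] by simp
    define c where "c = Poly_Mapping.lookup (Fs ! i) 0"
    have F_eq: "Fs ! i = Poly_Mapping.single 0 c"
      using graded_partD[OF F] mdeg_eq_0_iff
      by (intro poly_mapping_eqI) (auto simp: c_def lookup_single when_def)
    have mem: "Fs ! i \<in> ideal_gen (set Fs)" using i len by (intro ideal.span_base) auto
    have "1 \<in> ideal_gen (set Fs)"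
    proof (cases "c = 0")
      case True
      then have "Fs ! i * 1 \<in> ideal_gen (set (take i Fs))" by (simp add: F_eq ideal.span_zero)
      then have "1 \<in> ideal_gen (set (take i Fs))" by (rule nzdD[OF nzd[of i], rotated]) (simp add: i len)
      then show ?thesis using ideal.span_mono[OF set_take_subset[of i Fs]] by blast
    next
      case False
      then have "Poly_Mapping.single 0 (inverse c) * Fs ! i = 1" by (simp add: F_eq mult_single)
      then show ?thesis using ideal_gen_mult[OF mem, of "Poly_Mapping.single 0 (inverse c)"] by simp
    qed
    then show False using proper by (simp add: ideal_gen_eq_UNIV_iff)
  qed
  have "pos_homog f" if f: "f \<in> set Fs" for f
  proof -
    obtain i where i: "i < length Fs" "f = Fs ! i" using f by (metis in_set_conv_nth)
    then have "f \<in> graded_part (int (ds ! i))" "int (ds ! i) > 0" using deg[of i] pos[of i] len by simp_all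
    then show ?thesis unfolding pos_homog_def by blast
  qed
  then have "perm_reg_seq {} Fs" by (intro homog_reg_seq_perm rs) auto
  moreover have "list_all2 (\<lambda>f d. f \<in> graded_part (int d)) Fs ds"
    using len deg by (simp add: list_all2_conv_all_nth)
  moreover have "\<forall>d\<in>set ds. d > 0" using pos by (auto simp: in_set_conv_nth)
  ultimately show ?thesis using that[OF I proper] by blast
qed

lemma list_all2_permuted:
  assumes "list_all2 P xs ys" "mset ys' = mset ys"
  obtains xs' where "mset xs' = mset xs" "list_all2 P xs' ys'"
proof -
  have "list_all2 (\<lambda>y x. P x y) ys xs" using assms(1) by (simp add: list_all2_conv_all_nth)
  from list_all2_reorder_left_invariance[OF this assms(2)] obtain xs'
    where "list_all2 (\<lambda>y x. P x y) ys' xs'" "mset xs' = mset xs" by blast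
  then show ?thesis by (intro that[of xs']) (simp_all add: list_all2_conv_all_nth)
qed

theorem proposition3p2:
  fixes I :: "('x::finite, 'k::field_char_0) mpoly set"
    and ds :: "nat list" and r s :: nat
    and D :: "nat \<Rightarrow> int list"
    and \<phi> :: "nat \<Rightarrow> ('x, 'k) mpoly mat"
  assumes "complete_intersection I ds"
    and "r = length ds"
    and "s > 0"
    and "minimal_graded_free_resolution (ideal_power I s) r D \<phi>"
  shows "real_of_int (\<Prod>i=1..r. Min (set (D i))) / fact r \<le> quotient_multiplicity (ideal_power I s) \<and>
    quotient_multiplicity (ideal_power I s) \<le> real_of_int (\<Prod>i=1..r. Max (set (D i))) / fact r"
proof -
  obtain Fs where I: "I = ideal_gen (set Fs)" and proper: "ideal_gen (set Fs) \<noteq> UNIV"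
    and perm: "perm_reg_seq {} Fs" and deg: "list_all2 (\<lambda>f d. f \<in> graded_part (int d)) Fs ds"
    and pos: "\<forall>d\<in>set ds. d > 0"
    by (rule complete_intersectionE[OF assms(1)])
  have len: "length Fs = r" using deg assms(2) by (simp add: list_all2_lengthD)
  let ?J = "ideal_gen (prod_gens (set Fs) s)"
  let ?e = "((s + r - 1) choose r) * prod_list ds"
  have J: "ideal_power I s = ?J" unfolding I by (rule ideal_power_ideal_gen)
  have res: "graded_free_resolution ?J r D \<phi>"
    and min: "\<forall>i\<in>{1..r}. \<forall>j<length (D (i - 1)). \<forall>l<length (D i). \<phi> i $$ (j, l) \<in> irrelevant_ideal"
    using assms(4) unfolding J by (auto simp: minimal_graded_free_resolution_def)
  interpret graded_resolution ?J r D \<phi> by unfold_locales (rule res)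
  have mult: "quotient_multiplicity ?J = real ?e"
    using quotient_multiplicity_power[OF perm deg pos proper assms(3)] len by simp
  have shifts: "int ((s - 1) * es ! 0 + sum_list (take i es)) \<in> set (D i)"
    if es: "mset es = mset ds" and i: "i \<in> {1..r}" for es i
  proof -
    obtain fs where fs: "mset fs = mset Fs" "list_all2 (\<lambda>f d. f \<in> graded_part (int d)) fs es"
      by (rule list_all2_permuted[OF deg es])
    have sets: "set fs = set Fs" "length fs = r" "set es = set ds"
      using fs(1) es len by (metis set_mset_mset, metis size_mset, metis set_mset_mset)
    show ?thesis
    proof (rule initial_shift_mem[of fs s D \<phi>])
      show "perm_reg_seq {} fs" using perm perm_reg_seq_cong[OF fs(1)] by blast
    qed (use res fs sets pos i assms(3) in auto)
  qed
  \<comment> \<open>The value does not depend on the order \<open>es\<close>, so the increasing and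
    the decreasing arrangement are compared with the same number.\<close>
  have prod_eq: "(\<Prod>i=1..r. int ((s - 1 + i) * es ! (i - 1))) = fact r * int ?e"
    if es: "mset es = mset ds" for es
  proof -
    have "prod_list es = prod_list ds" "length es = r"
      using es assms(2) by (metis prod_mset_prod_list, metis size_mset)
    then have "int (\<Prod>i=1..r. (s - 1 + i) * es ! (i - 1)) = int (fact r * ?e)"
      using prod_rising_factors_list[OF assms(3), of es r] by simp
    then show ?thesis by (simp only: of_nat_prod of_nat_mult of_nat_fact)
  qed
  have "(\<Prod>i=1..r. Min (set (D i))) \<le> (\<Prod>i=1..r. int ((s - 1 + i) * sort ds ! (i - 1)))"
  proof (rule prod_mono)
    fix i assume i: "i \<in> {1..r}"
    note mem = shifts[of "sort ds" i, OF mset_sort i]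
    have "Min (set (D i)) \<le> int ((s - 1) * sort ds ! 0 + sum_list (take i (sort ds)))"
      using mem by (intro Min_le) auto
    also have "\<dots> \<le> int ((s - 1 + i) * sort ds ! (i - 1))"
      using i assms(2) by (intro of_nat_mono sum_list_take_le_sorted) auto
    finally have "Min (set (D i)) \<le> int ((s - 1 + i) * sort ds ! (i - 1))" .
    \<comment> \<open>Multiplying the inequalities requires nonnegative left-hand sides; here the
      minimum is itself a shift of the minimal resolution.\<close>
    moreover have "Min (set (D i)) \<in> set (D i)" using mem by (intro Min_in) auto
    then have "0 \<le> Min (set (D i))" using minimal_shifts_nonneg[OF min] i by auto
    ultimately show "0 \<le> Min (set (D i)) \<and> Min (set (D i)) \<le> int ((s - 1 + i) * sort ds ! (i - 1))"
      by simp
  qed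
  then have lower: "(\<Prod>i=1..r. Min (set (D i))) \<le> fact r * int ?e"
    using prod_eq[of "sort ds"] by simp
  have "(\<Prod>i=1..r. int ((s - 1 + i) * rev (sort ds) ! (i - 1))) \<le> (\<Prod>i=1..r. Max (set (D i)))"
  proof (rule prod_mono)
    fix i assume i: "i \<in> {1..r}"
    let ?es = "rev (sort ds)"
    have "mset ?es = mset ds" by simp
    note mem = shifts[of ?es i, OF this i]
    have "int ((s - 1 + i) * ?es ! (i - 1)) \<le> int ((s - 1) * ?es ! 0 + sum_list (take i ?es))"
      using i assms(2) by (intro of_nat_mono sum_list_take_ge_sorted) (auto simp: sorted_wrt_rev)
    also have "\<dots> \<le> Max (set (D i))" using mem by (intro Max_ge) auto
    finally show "0 \<le> int ((s - 1 + i) * ?es ! (i - 1)) \<and> int ((s - 1 + i) * ?es ! (i - 1)) \<le> Max (set (D i))"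
      by simp
  qed
  then have upper: "fact r * int ?e \<le> (\<Prod>i=1..r. Max (set (D i)))"
    using prod_eq[of "rev (sort ds)"] by simp
  have e_real: "real_of_int (fact r * int ?e) = fact r * real ?e"
    by (simp only: of_int_mult of_int_fact of_int_of_nat_eq)
  have "real_of_int (\<Prod>i=1..r. Min (set (D i))) \<le> fact r * real ?e"
    unfolding e_real[symmetric] of_int_le_iff by (rule lower)
  moreover have "fact r * real ?e \<le> real_of_int (\<Prod>i=1..r. Max (set (D i)))"
    unfolding e_real[symmetric] of_int_le_iff by (rule upper)
  ultimately show ?thesis
    unfolding J mult by (simp add: divide_le_eq le_divide_eq mult.commute)
qed

end
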